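(* (i) Let $K\subset\{(x,y)\in\mathbb{R}^2:0<x\le y\}$ be compact and $E=\{\xi\in\mathbb{R}^{2\times2}:(\lambda_1(\xi),\lambda_2(\xi))\in K\}$. Then $E^{rc}=E^{pc}=\operatorname{Pco}E$. (ii) If $U$ is an open, bounded, isotropic subset of $\mathbb{R}^{2\times2}$, then $U^{rc}=U^{pc}=\operatorname{Pco}U$ and $(U^{rc})^{rc}=U^{rc}$.
   Context: For $\xi\in\mathbb{R}^{2\times2}$, $0\le\lambda_1(\xi)\le\lambda_2(\xi)$ are its singular values (eigenvalues of $\sqrt{\xi\xi^t}$). A set is isotropic if $RES\subseteq E$ for all orthogonal $R,S$. With $T(\xi)=(\xi,\det\xi)\in\mathbb{R}^5$ for $\xi\in\mathbb{R}^{2\times2}$: a function $f$ is polyconvex if $f=g\circ T$ with $g$ convex; rank one convex if convex along segments $[\xi,\eta]$ with $\operatorname{rank}(\xi-\eta)=1$. A set $E\subset\mathbb{R}^{2\times2}$ is polyconvex if for all $\xi_i\in E$, $t_i\ge0$, $\sum_{i=1}^5t_i=1$ with $\sum t_i\det\xi_i=\det(\sum t_i\xi_i)$ one has $\sum t_i\xi_i\in E$; $\operatorname{Pco}E$ is the smallest polyconvex set containing $E$. For compact $E$: $E^{pc}$ (resp. $E^{rc}$) is the set of $\xi$ with $f(\xi)\le0$ for every real-valued polyconvex (resp. rank one convex) $f$ with $f|_E\le0$. For open $U$: $U^{pc}=\bigcup_{E\subset U\text{ compact}}E^{pc}$, $U^{rc}=\bigcup_{E\subset U\text{ compact}}E^{rc}$.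 *)

theory Defs
  imports "HOL-Analysis.Analysis"
begin

type_synonym mat2 = "real^2^2"

definition msqrt :: "mat2 \<Rightarrow> mat2" where
  "msqrt M = (THE P. transpose P = P \<and> (\<forall>v. 0 \<le> v \<bullet> (P *v v)) \<and> P ** P = M)"

definition sing_vals :: "mat2 \<Rightarrow> real \<times> real" where
  "sing_vals \<xi> = (THE p. 0 \<le> fst p \<and> fst p \<le> snd p \<and>
     (\<forall>t::real. det (t *\<^sub>R mat 1 - msqrt (\<xi> ** transpose \<xi>)) = (t - fst p) * (t - snd p)))"

definition lambda1 :: "mat2 \<Rightarrow> real" where "lambda1 \<xi> = fst (sing_vals \<xi>)"
definition lambda2 :: "mat2 \<Rightarrow> real" where "lambda2 \<xi> = snd (sing_vals \<xi>)"

definition isotropic :: "mat2 set \<Rightarrow> bool" where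
  "isotropic E \<longleftrightarrow> (\<forall>R S \<xi>. orthogonal_matrix R \<and> orthogonal_matrix S \<and> \<xi> \<in> E \<longrightarrow> R ** \<xi> ** S \<in> E)"

definition polyconvex_fun :: "(mat2 \<Rightarrow> real) \<Rightarrow> bool" where
  "polyconvex_fun f \<longleftrightarrow> (\<exists>g :: mat2 \<times> real \<Rightarrow> real. convex_on UNIV g \<and> (\<forall>\<xi>. f \<xi> = g (\<xi>, det \<xi>)))"

definition rank_one_convex :: "(mat2 \<Rightarrow> real) \<Rightarrow> bool" where
  "rank_one_convex f \<longleftrightarrow> (\<forall>\<xi> \<eta>. rank (\<xi> - \<eta>) = 1 \<longrightarrow> convex_on (closed_segment \<xi> \<eta>) f)"

definition polyconvex_set :: "mat2 set \<Rightarrow> bool" where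
  "polyconvex_set E \<longleftrightarrow> (\<forall>(\<xi>::nat \<Rightarrow> mat2) (t::nat \<Rightarrow> real).
      (\<forall>i\<in>{1..5}. \<xi> i \<in> E \<and> 0 \<le> t i) \<and> (\<Sum>i=1..5. t i) = 1 \<and>
      (\<Sum>i=1..5. t i * det (\<xi> i)) = det (\<Sum>i=1..5. t i *\<^sub>R \<xi> i)
      \<longrightarrow> (\<Sum>i=1..5. t i *\<^sub>R \<xi> i) \<in> E)"

definition Pco :: "mat2 set \<Rightarrow> mat2 set" where
  "Pco E = \<Inter>{F. E \<subseteq> F \<and> polyconvex_set F}"

definition pc_hull :: "mat2 set \<Rightarrow> mat2 set" where
  "pc_hull E = {\<xi>. \<forall>f. polyconvex_fun f \<and> (\<forall>x\<in>E. f x \<le> 0) \<longrightarrow> f \<xi> \<le> 0}"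

definition rc_hull :: "mat2 set \<Rightarrow> mat2 set" where
  "rc_hull E = {\<xi>. \<forall>f. rank_one_convex f \<and> (\<forall>x\<in>E. f x \<le> 0) \<longrightarrow> f \<xi> \<le> 0}"

definition pc_hull_open :: "mat2 set \<Rightarrow> mat2 set" where
  "pc_hull_open U = \<Union>{pc_hull E | E. E \<subseteq> U \<and> compact E}"

definition rc_hull_open :: "mat2 set \<Rightarrow> mat2 set" where
  "rc_hull_open U = \<Union>{rc_hull E | E. E \<subseteq> U \<and> compact E}"

end

(* Write a matrix in conformal coordinates as v |-> z v + w (cnj v). Then det = |z|^2 - |w|^2, the
   singular values are | |z| - |w| | and |z| + |w|, and a difference has rank at most one iff its
   z and w parts have equal modulus.

   For a compact E described by singular values, let L be its lamination hull, the smallest set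
   containing E and closed under rank-one segments. Then L lies in every hull in question, and each of
   them lies in the polyconvex hull, so it suffices that the polyconvex hull lies in L. In the
   coordinates (D, r) = (det, |w|) the part of L with D >= 0 is convex and closed under
   decreasing D and r. A point outside it is separated from the compact convex set
   spanned by E and (0, max lambda2 / 2) by a functional c D + k r with c, k >= 0, and
   c det + k |w| and -c det + k |z| are polyconvex. For open U one exhausts
   by compact sets; idempotence follows from translation invariance, since the hull of a compact
   subset of U lies in the interior of the hull of a slightly larger one. *)
theory Submission
  imports Defs
begin

section \<open>Conformal coordinates on real 2 x 2 matrices\<close>

text \<open>Identifying the plane with \<open>\<complex>\<close>, the matrix \<open>\<xi>\<close> acts as
  \<open>v \<mapsto> zc \<xi> * v + wc \<xi> * cnj v\<close>.\<close>

definition zc :: "mat2 \<Rightarrow> complex" where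
  "zc \<xi> = Complex ((\<xi>$1$1 + \<xi>$2$2) / 2) ((\<xi>$2$1 - \<xi>$1$2) / 2)"

definition wc :: "mat2 \<Rightarrow> complex" where
  "wc \<xi> = Complex ((\<xi>$1$1 - \<xi>$2$2) / 2) ((\<xi>$2$1 + \<xi>$1$2) / 2)"

definition mk :: "complex \<Rightarrow> complex \<Rightarrow> mat2" where
  "mk z w = vector [vector [Re z + Re w, Im w - Im z], vector [Im z + Im w, Re z - Re w]]"

lemma mk_nth [simp]:
  "mk z w $ 1 $ 1 = Re z + Re w" "mk z w $ 1 $ 2 = Im w - Im z"
  "mk z w $ 2 $ 1 = Im z + Im w" "mk z w $ 2 $ 2 = Re z - Re w"
  by (simp_all add: mk_def)

lemma zc_mk [simp]: "zc (mk z w) = z" and wc_mk [simp]: "wc (mk z w) = w"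
  by (simp_all add: zc_def wc_def complex_eq_iff)

lemma mat2_eq_iff: "\<xi> = \<eta> \<longleftrightarrow> \<xi>$1$1 = \<eta>$1$1 \<and> \<xi>$1$2 = \<eta>$1$2 \<and> \<xi>$2$1 = \<eta>$2$1 \<and> \<xi>$2$2 = \<eta>$2$2"
  for \<xi> \<eta> :: mat2
  by (auto simp: vec_eq_iff forall_2)

lemma mk_zc_wc [simp]: "mk (zc \<xi>) (wc \<xi>) = \<xi>"
  by (simp add: mat2_eq_iff zc_def wc_def field_simps)

lemma linear_zc: "linear zc" and linear_wc: "linear wc"
  by (auto intro!: linearI simp: zc_def wc_def complex_eq_iff algebra_simps add_divide_distrib diff_divide_distrib)

lemmas zc_simps [simp] = linear_add[OF linear_zc] linear_diff[OF linear_zc] linear_scale[OF linear_zc]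
lemmas wc_simps [simp] = linear_add[OF linear_wc] linear_diff[OF linear_wc] linear_scale[OF linear_wc]

lemma mk_diff: "mk z w - mk z' w' = mk (z - z') (w - w')"
  and mk_add: "mk z w + mk z' w' = mk (z + z') (w + w')"
  and mk_scaleR: "c *\<^sub>R mk z w = mk (c *\<^sub>R z) (c *\<^sub>R w)"
  by (simp_all add: mat2_eq_iff algebra_simps)

lemma det_conformal: "det \<xi> = (cmod (zc \<xi>))\<^sup>2 - (cmod (wc \<xi>))\<^sup>2"
  unfolding cmod_power2 by (simp add: det_2 zc_def wc_def power2_eq_square field_simps)

text \<open>\<open>det\<close> is a quadratic form, so its deviation from affinity on a segment is
  governed by \<open>det (\<xi> - \<eta>)\<close> alone. On rank-one segments it is affine, which
  drives most arguments below.\<close>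

lemma det_segment:
  fixes \<xi> \<eta> :: mat2
  shows "det ((1 - t) *\<^sub>R \<xi> + t *\<^sub>R \<eta>) = (1 - t) * det \<xi> + t * det \<eta> - t * (1 - t) * det (\<xi> - \<eta>)"
  by (simp add: det_2 algebra_simps)

section \<open>Singular values\<close>

text \<open>By Cayley-Hamilton, \<open>P ** P\<close> equals \<open>trace P *\<^sub>R P\<close>
  minus \<open>det P\<close> times the identity. Since trace and determinant of \<open>P\<close> can
  be read off \<open>M\<close>, this both determines the root and suggests a formula for it.\<close>

lemma sqrt_matrix_char:
  fixes P M :: mat2
  assumes sym: "transpose P = P" and psd: "\<forall>v. 0 \<le> v \<bullet> (P *v v)" and sq: "P ** P = M"
  shows "0 \<le> trace P" "0 \<le> det P" "det P = sqrt (det M)" "trace P = sqrt (trace M + 2 * sqrt (det M))"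
    "trace P *\<^sub>R P = M + sqrt (det M) *\<^sub>R mat 1" "trace P = 0 \<Longrightarrow> P = 0"
proof -
  have s: "P$1$2 = P$2$1"
    using arg_cong[OF sym, of "\<lambda>A. A$1$2"] by (simp add: transpose_def)
  have q: "0 \<le> a * (P$1$1 * a + P$1$2 * b) + b * (P$2$1 * a + P$2$2 * b)" for a b
    using spec[OF psd, of "vector [a, b]"]
    by (simp add: inner_vec_def sum_2 matrix_vector_mult_def)
  have p1: "0 \<le> P$1$1" and p2: "0 \<le> P$2$2" using q[of 1 0] q[of 0 1] by simp_all
  show t: "0 \<le> trace P" using p1 p2 by (simp add: trace_def sum_2)
  show d: "0 \<le> det P"
  proof (cases "P$1$1 = 0")
    case True
    have "P$1$2 = 0"
    proof (rule ccontr)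
      assume n: "P$1$2 \<noteq> 0"
      \<comment> \<open>With a zero corner entry the form is affine in \<open>a\<close>; the value
        of \<open>a\<close> chosen next makes it equal to -1.\<close>
      have "0 \<le> 2 * a * P$1$2 + P$2$2" for a
        using q[of a 1] True s by (simp add: algebra_simps)
      from this[of "- (P$2$2 + 1) / (2 * P$1$2)"] n show False by (simp add: field_simps)
    qed
    then show ?thesis using True s by (simp add: det_2)
  next
    case False
    have "0 \<le> P$1$1 * det P" using q[of "P$1$2" "- P$1$1"] s by (simp add: det_2 algebra_simps)
    then show ?thesis using False p1 by (simp add: zero_le_mult_iff)
  qed
  have dm: "det M = (det P)\<^sup>2" unfolding sq[symmetric] by (simp add: det_mul power2_eq_square)
  then show dP: "det P = sqrt (det M)" using d by simp
  have M: "M$1$1 = P$1$1 * P$1$1 + P$1$2 * P$2$1" "M$2$2 = P$2$1 * P$1$2 + P$2$2 * P$2$2"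
     "M$1$2 = P$1$1 * P$1$2 + P$1$2 * P$2$2" "M$2$1 = P$2$1 * P$1$1 + P$2$2 * P$2$1"
    unfolding sq[symmetric] by (simp_all add: matrix_matrix_mult_def sum_2)
  have "(trace P)\<^sup>2 = trace M + 2 * det P"
    by (simp add: trace_def sum_2 M det_2 power2_eq_square algebra_simps)
  then show "trace P = sqrt (trace M + 2 * sqrt (det M))" using t dP
    by (metis real_sqrt_unique)
  show "trace P *\<^sub>R P = M + sqrt (det M) *\<^sub>R mat 1"
    unfolding dP[symmetric]
    by (simp add: mat2_eq_iff M trace_def sum_2 det_2 mat_def algebra_simps)
  assume "trace P = 0"
  then have z: "P$1$1 = 0" "P$2$2 = 0" using p1 p2 by (simp_all add: trace_def sum_2)
  moreover have "P$1$2 = 0"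
  proof -
    have "(P$1$2)\<^sup>2 \<le> 0" using d z s by (simp add: det_2 power2_eq_square)
    then show ?thesis by simp
  qed
  ultimately show "P = 0" using s by (simp add: mat2_eq_iff)
qed

text \<open>Existence and uniqueness of the root are both needed to resolve the \<open>THE\<close>
  in \<open>msqrt\<close>. Afterwards its trace and determinant follow from
  \<open>sqrt_matrix_char\<close>.\<close>

lemma msqrt_properties:
  fixes \<xi> :: mat2
  defines "M \<equiv> \<xi> ** transpose \<xi>"
  shows "trace (msqrt M) = 2 * max (cmod (zc \<xi>)) (cmod (wc \<xi>))" "det (msqrt M) = \<bar>det \<xi>\<bar>"
proof -
  define \<delta> where "\<delta> = \<bar>det \<xi>\<bar>"
  define \<tau> where "\<tau> = 2 * max (cmod (zc \<xi>)) (cmod (wc \<xi>))"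
  have M: "M$1$1 = (\<xi>$1$1)\<^sup>2 + (\<xi>$1$2)\<^sup>2" "M$2$2 = (\<xi>$2$1)\<^sup>2 + (\<xi>$2$2)\<^sup>2"
     "M$1$2 = \<xi>$1$1 * \<xi>$2$1 + \<xi>$1$2 * \<xi>$2$2" "M$2$1 = \<xi>$1$1 * \<xi>$2$1 + \<xi>$1$2 * \<xi>$2$2"
    unfolding M_def by (simp_all add: matrix_matrix_mult_def sum_2 transpose_def power2_eq_square mult.commute)
  have dM: "det M = (det \<xi>)\<^sup>2" unfolding M_def by (simp add: det_mul det_transpose power2_eq_square)
  then have sd: "sqrt (det M) = \<delta>" by (simp add: \<delta>_def)
  have trM: "trace M = 2 * (cmod (zc \<xi>))\<^sup>2 + 2 * (cmod (wc \<xi>))\<^sup>2"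
    unfolding cmod_power2 by (simp add: trace_def sum_2 M zc_def wc_def power2_eq_square field_simps)
  have max2: "(2 * max a b)\<^sup>2 = 2 * a\<^sup>2 + 2 * b\<^sup>2 + 2 * \<bar>a\<^sup>2 - b\<^sup>2\<bar>" if "0 \<le> a" "0 \<le> b" for a b :: real
    using that power_mono[of a b 2] power_mono[of b a 2]
    by (cases "a \<le> b") (simp_all add: max_def)
  have tau2: "\<tau>\<^sup>2 = trace M + 2 * \<delta>"
    unfolding trM \<delta>_def det_conformal \<tau>_def using max2 by simp
  have tau0: "0 \<le> \<tau>" by (simp add: \<tau>_def max_def)
  have st: "sqrt (trace M + 2 * sqrt (det M)) = \<tau>" using tau2 tau0 sd by (metis real_sqrt_unique)
  define Q where "Q = (\<lambda>P. transpose P = P \<and> (\<forall>v. 0 \<le> v \<bullet> (P *v v)) \<and> P ** P = M)"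
  have uniq: "P = P'" if "Q P" "Q P'" for P P'
  proof (cases "\<tau> = 0")
    case True
    then show ?thesis using that sqrt_matrix_char(4,6)[of P M] sqrt_matrix_char(4,6)[of P' M] st
      by (simp add: Q_def)
  next
    case False
    have "\<tau> *\<^sub>R P = \<tau> *\<^sub>R P'"
      using that sqrt_matrix_char(4,5)[of P M] sqrt_matrix_char(4,5)[of P' M] st
      by (simp add: Q_def)
    then show ?thesis using False by simp
  qed
  \<comment> \<open>The trace identity solved for the root. If \<open>\<tau> = 0\<close>, division
    by zero yields \<open>P = 0\<close>, which is correct because then
    \<open>\<xi> = 0\<close>.\<close>
  define P where "P = (1 / \<tau>) *\<^sub>R (M + \<delta> *\<^sub>R mat 1)"
  have P: "P$1$1 = (M$1$1 + \<delta>) / \<tau>" "P$2$2 = (M$2$2 + \<delta>) / \<tau>" "P$1$2 = M$1$2 / \<tau>" "P$2$1 = M$1$2 / \<tau>"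
    by (simp_all add: P_def mat_def M)
  have "Q P"
  proof -
    have "transpose P = P" by (simp add: mat2_eq_iff transpose_def P)
    moreover have "0 \<le> v \<bullet> (P *v v)" for v
    proof -
      \<comment> \<open>The first two squares are the squared length of the transpose of
        \<open>\<xi>\<close> applied to \<open>v\<close>.\<close>
      have "v \<bullet> (P *v v) = ((\<xi>$1$1 * v$1 + \<xi>$2$1 * v$2)\<^sup>2 + (\<xi>$1$2 * v$1 + \<xi>$2$2 * v$2)\<^sup>2 + \<delta> * ((v$1)\<^sup>2 + (v$2)\<^sup>2)) / \<tau>"
        by (simp add: inner_vec_def sum_2 matrix_vector_mult_def P M power2_eq_square add_divide_distrib algebra_simps)
      then show ?thesis using tau0 by (simp add: \<delta>_def)
    qed
    moreover have "P ** P = M"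
    proof (cases "\<tau> = 0")
      case True
      then have "zc \<xi> = 0" "wc \<xi> = 0" by (auto simp: \<tau>_def max_def split: if_splits)
      then have "\<xi> = 0" by (metis mk_zc_wc linear_0 linear_zc linear_wc)
      then show ?thesis using True by (simp add: mat2_eq_iff M P matrix_matrix_mult_def sum_2)
    next
      case False
      have d2: "\<delta>\<^sup>2 = M$1$1 * M$2$2 - M$1$2 * M$1$2"
        using dM M by (simp add: \<delta>_def det_2)
      have t2: "\<tau> * \<tau> = M$1$1 + M$2$2 + 2 * \<delta>"
        using tau2 by (simp add: trace_def sum_2 power2_eq_square)
      have m: "M$2$1 = M$1$2" using M by simp
      have e: "(p + \<delta>) * (p + \<delta>) + m * m = (\<tau> * \<tau>) * p" "(p + \<delta>) * m + m * (q + \<delta>) = (\<tau> * \<tau>) * m"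
        if "\<delta>\<^sup>2 = p * q - m * m" "\<tau> * \<tau> = p + q + 2 * \<delta>" for p q m
        using that by algebra+
      have f: "a / \<tau> * (b / \<tau>) + c / \<tau> * (d / \<tau>) = r" if "a * b + c * d = (\<tau> * \<tau>) * r" for a b c d r
      proof -
        have "a / \<tau> * (b / \<tau>) + c / \<tau> * (d / \<tau>) = (a * b + c * d) / (\<tau> * \<tau>)"
          by (simp add: add_divide_distrib)
        then show ?thesis using that False by simp
      qed
      have d2': "\<delta>\<^sup>2 = M$2$2 * M$1$1 - M$1$2 * M$1$2" and t2': "\<tau> * \<tau> = M$2$2 + M$1$1 + 2 * \<delta>"
        using d2 t2 by (simp_all add: mult.commute)
      have PP: "(P ** P)$i$j = P$i$1 * P$1$j + P$i$2 * P$2$j" for i j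
        by (simp add: matrix_matrix_mult_def sum_2)
      have "(P ** P)$1$1 = M$1$1" "(P ** P)$2$2 = M$2$2" "(P ** P)$1$2 = M$1$2" "(P ** P)$2$1 = M$2$1"
        using f[OF e(1)[OF d2 t2]] f[OF trans[OF add.commute e(1)[OF d2' t2']]]
          f[OF e(2)[OF d2 t2]] f[OF trans[OF add.commute e(2)[OF d2' t2']]]
        by (simp_all only: PP P m)
      then show ?thesis by (simp only: mat2_eq_iff)
    qed
    ultimately show ?thesis by (simp add: Q_def)
  qed
  then have "msqrt M = P" unfolding msqrt_def Q_def[symmetric] using uniq by (intro the_equality) auto
  then have "Q (msqrt M)" using \<open>Q P\<close> by simp
  then show "trace (msqrt M) = 2 * max (cmod (zc \<xi>)) (cmod (wc \<xi>))" "det (msqrt M) = \<bar>det \<xi>\<bar>"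
    using sqrt_matrix_char(3,4)[of "msqrt M" M] st sd unfolding Q_def \<tau>_def \<delta>_def by auto
qed

lemma sing_vals_conformal:
  "sing_vals \<xi> = (\<bar>cmod (zc \<xi>) - cmod (wc \<xi>)\<bar>, cmod (zc \<xi>) + cmod (wc \<xi>))"
proof -
  define a where "a = \<bar>cmod (zc \<xi>) - cmod (wc \<xi>)\<bar>"
  define b where "b = cmod (zc \<xi>) + cmod (wc \<xi>)"
  define N where "N = msqrt (\<xi> ** transpose \<xi>)"
  have ab: "0 \<le> a" "a \<le> b" by (auto simp: a_def b_def abs_le_iff add_increasing)
  have "2 * max (cmod (zc \<xi>)) (cmod (wc \<xi>)) = a + b" by (simp add: a_def b_def max_def)
  moreover have "\<bar>(cmod (zc \<xi>))\<^sup>2 - (cmod (wc \<xi>))\<^sup>2\<bar> = a * b"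
    by (simp add: a_def b_def square_diff_square_factored power2_eq_square abs_mult)
  ultimately have tr: "trace N = a + b" and dt: "det N = a * b"
    using msqrt_properties[of \<xi>] by (simp_all add: N_def det_conformal)
  have ch: "det (t *\<^sub>R mat 1 - N) = t\<^sup>2 - trace N * t + det N" for t
    by (simp add: det_2 trace_def sum_2 mat_def power2_eq_square algebra_simps)
  have "sing_vals \<xi> = (a, b)"
    unfolding sing_vals_def N_def[symmetric]
  proof (rule the_equality)
    show "0 \<le> fst (a, b) \<and> fst (a, b) \<le> snd (a, b) \<and> (\<forall>t. det (t *\<^sub>R mat 1 - N) = (t - fst (a, b)) * (t - snd (a, b)))"
      using ab unfolding ch by (simp add: tr dt power2_eq_square algebra_simps)
    fix p :: "real \<times> real"
    assume p: "0 \<le> fst p \<and> fst p \<le> snd p \<and> (\<forall>t. det (t *\<^sub>R mat 1 - N) = (t - fst p) * (t - snd p))"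
    obtain x y where xy: "p = (x, y)" by (cases p)
    have e: "t\<^sup>2 - (a + b) * t + a * b = (t - x) * (t - y)" for t
      using p ch[of t] by (simp add: xy tr dt)
    have "a * b = x * y" "a + b = x + y" using e[of 0] e[of 1] by (simp_all add: algebra_simps)
    \<comment> \<open>Sum and product determine the squared gap; the ordering of each pair removes
      the sign ambiguity.\<close>
    then have "(b - a)\<^sup>2 = (y - x)\<^sup>2" by algebra
    then have "b - a = y - x" using p ab xy by (simp add: power2_eq_iff_nonneg)
    then show "p = (a, b)" using \<open>a + b = x + y\<close> xy by auto
  qed
  then show ?thesis by (simp add: a_def b_def)
qed

lemma lambda1_conformal: "lambda1 \<xi> = \<bar>cmod (zc \<xi>) - cmod (wc \<xi>)\<bar>"
  and lambda2_conformal: "lambda2 \<xi> = cmod (zc \<xi>) + cmod (wc \<xi>)"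
  by (simp_all add: lambda1_def lambda2_def sing_vals_conformal)

section \<open>Lamination hulls and general properties of hulls\<close>

inductive_set lamination_hull :: "mat2 set \<Rightarrow> mat2 set" for E where
  lam_base: "\<xi> \<in> E \<Longrightarrow> \<xi> \<in> lamination_hull E"
| lam_step: "\<xi> \<in> lamination_hull E \<Longrightarrow> \<eta> \<in> lamination_hull E \<Longrightarrow> det (\<xi> - \<eta>) = 0 \<Longrightarrow> 0 \<le> t \<Longrightarrow> t \<le> 1 \<Longrightarrow>
    (1 - t) *\<^sub>R \<xi> + t *\<^sub>R \<eta> \<in> lamination_hull E"

lemma rank_eq_1_iff: "rank \<xi> = 1 \<longleftrightarrow> det \<xi> = 0 \<and> \<xi> \<noteq> 0" for \<xi> :: mat2
proof -
  have "det \<xi> = 0 \<longleftrightarrow> rank \<xi> < 2"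
    using invertible_det_nz[of \<xi>] less_rank_noninjective[of \<xi>]
    by (auto simp: invertible_left_inverse matrix_left_invertible_injective)
  then show ?thesis using rank_eq_0[of \<xi>] by linarith
qed

text \<open>On a rank-one segment \<open>det\<close> is affine, hence so is the lift
  \<open>\<xi> \<mapsto> (\<xi>, det \<xi>)\<close>, and convexity of \<open>g\<close> pulls
  back.\<close>

lemma polyconvex_fun_imp_rank_one_convex:
  assumes "polyconvex_fun f"
  shows "rank_one_convex f"
  unfolding rank_one_convex_def
proof (intro allI impI)
  fix \<xi> \<eta> :: mat2
  assume "rank (\<xi> - \<eta>) = 1"
  then have d0: "det (\<xi> - \<eta>) = 0" unfolding rank_eq_1_iff by simp
  obtain g :: "mat2 \<times> real \<Rightarrow> real" where g: "convex_on UNIV g" "\<And>\<xi>. f \<xi> = g (\<xi>, det \<xi>)"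
    using assms unfolding polyconvex_fun_def by auto
  show "convex_on (closed_segment \<xi> \<eta>) f"
  proof (rule convex_onI)
    fix t :: real and a b
    assume t: "0 < t" "t < 1" and ab: "a \<in> closed_segment \<xi> \<eta>" "b \<in> closed_segment \<xi> \<eta>"
    obtain u v where uv: "a = (1 - u) *\<^sub>R \<xi> + u *\<^sub>R \<eta>" "b = (1 - v) *\<^sub>R \<xi> + v *\<^sub>R \<eta>"
      using ab by (auto simp: in_segment)
    have "a - b = (v - u) *\<^sub>R (\<xi> - \<eta>)" by (simp add: uv algebra_simps)
    moreover have "det (c *\<^sub>R \<zeta>) = c\<^sup>2 * det \<zeta>" for c and \<zeta> :: mat2
      by (simp add: det_2 power2_eq_square algebra_simps)
    ultimately have "det (a - b) = 0" using d0 by simp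
    then have "det ((1 - t) *\<^sub>R a + t *\<^sub>R b) = (1 - t) * det a + t * det b"
      by (simp add: det_segment)
    then show "f ((1 - t) *\<^sub>R a + t *\<^sub>R b) \<le> (1 - t) * f a + t * f b"
      using convex_onD[OF g(1), of t "(a, det a)" "(b, det b)"] t by (simp add: g(2))
  qed simp
qed

lemma rc_hull_subset_pc_hull: "rc_hull E \<subseteq> pc_hull E"
  using polyconvex_fun_imp_rank_one_convex by (auto simp: rc_hull_def pc_hull_def)

text \<open>The set where a rank-one convex function is nonpositive is closed under rank-one
  segments.\<close>

lemma lam_subset_rc_hull: "lamination_hull E \<subseteq> rc_hull E"
proof
  fix \<xi> assume "\<xi> \<in> lamination_hull E"
  then show "\<xi> \<in> rc_hull E"
  proof induction
    case (lam_base \<xi>)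
    then show ?case by (simp add: rc_hull_def)
  next
    case (lam_step \<xi> \<eta> t)
    show ?case
    proof (cases "\<xi> = \<eta>")
      case True
      then show ?thesis using lam_step.IH(1) by (simp flip: scaleR_left_distrib)
    next
      case False
      then have r: "rank (\<xi> - \<eta>) = 1" using lam_step unfolding rank_eq_1_iff by simp
      show ?thesis unfolding rc_hull_def
      proof clarify
        fix f assume f: "rank_one_convex f" "\<forall>x\<in>E. f x \<le> 0"
        have "f \<xi> \<le> 0" "f \<eta> \<le> 0" using lam_step.IH f by (auto simp: rc_hull_def)
        moreover have "f ((1 - t) *\<^sub>R \<xi> + t *\<^sub>R \<eta>) \<le> (1 - t) * f \<xi> + t * f \<eta>"
          using f(1) r lam_step.hyps unfolding rank_one_convex_def
          by (intro convex_onD[of "closed_segment \<xi> \<eta>"]) auto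
        ultimately show "f ((1 - t) *\<^sub>R \<xi> + t *\<^sub>R \<eta>) \<le> 0"
          using lam_step.hyps mult_nonneg_nonpos[of "1 - t" "f \<xi>"] mult_nonneg_nonpos[of t "f \<eta>"] by linarith
      qed
    qed
  qed
qed

lemma atLeastAtMost_1_5: "{Suc 0..5} = {1, 2, 3, 4, 5}"
  by auto

text \<open>A segment is a five-point combination with three zero weights; its determinant condition
  holds because \<open>det\<close> is affine in rank-one directions.\<close>

lemma polyconvex_set_rank_one_segment:
  assumes "polyconvex_set F" "\<xi> \<in> F" "\<eta> \<in> F" "det (\<xi> - \<eta>) = 0" "0 \<le> t" "t \<le> 1"
  shows "(1 - t) *\<^sub>R \<xi> + t *\<^sub>R \<eta> \<in> F"
proof -
  define X where "X = (\<lambda>i::nat. if i = 1 then \<xi> else \<eta>)"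
  define s where "s = (\<lambda>i::nat. if i = 1 then 1 - t else if i = 2 then t else 0)"
  have sm: "(\<Sum>i=1..5. s i *\<^sub>R X i) = (1 - t) *\<^sub>R \<xi> + t *\<^sub>R \<eta>"
    by (simp add: atLeastAtMost_1_5 X_def s_def)
  have "(\<Sum>i=1..5. s i * det (X i)) = (1 - t) * det \<xi> + t * det \<eta>"
    by (simp add: atLeastAtMost_1_5 X_def s_def)
  then have "(\<Sum>i=1..5. s i * det (X i)) = det (\<Sum>i=1..5. s i *\<^sub>R X i)"
    unfolding sm det_segment using assms(4) by simp
  moreover have "(\<Sum>i=1..5. s i) = 1" by (simp add: atLeastAtMost_1_5 s_def)
  moreover have "\<forall>i\<in>{1..5}. X i \<in> F \<and> 0 \<le> s i" using assms by (auto simp: X_def s_def)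
  ultimately show ?thesis using assms(1) unfolding polyconvex_set_def sm[symmetric] by blast
qed

lemma lam_subset_Pco: "lamination_hull E \<subseteq> Pco E"
proof
  fix \<xi> assume "\<xi> \<in> lamination_hull E"
  then show "\<xi> \<in> Pco E"
  proof induction
    case (lam_base \<xi>)
    then show ?case by (auto simp: Pco_def)
  next
    case (lam_step \<xi> \<eta> t)
    then show ?case unfolding Pco_def by (auto intro: polyconvex_set_rank_one_segment)
  qed
qed

text \<open>The determinant condition says that the lift of the combination is the combination of
  the lifts, so Jensen's inequality applies to \<open>g\<close>.\<close>

lemma polyconvex_set_pc_hull: "polyconvex_set (pc_hull E)"
  unfolding polyconvex_set_def
proof clarify
  fix \<xi> :: "nat \<Rightarrow> mat2" and t :: "nat \<Rightarrow> real"
  assume h: "\<forall>i\<in>{1..5}. \<xi> i \<in> pc_hull E \<and> 0 \<le> t i" and t: "(\<Sum>i=1..5. t i) = 1"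
    and d: "(\<Sum>i=1..5. t i * det (\<xi> i)) = det (\<Sum>i=1..5. t i *\<^sub>R \<xi> i)"
  show "(\<Sum>i=1..5. t i *\<^sub>R \<xi> i) \<in> pc_hull E"
    unfolding pc_hull_def
  proof clarify
    fix f assume f: "polyconvex_fun f" "\<forall>x\<in>E. f x \<le> 0"
    then obtain g :: "mat2 \<times> real \<Rightarrow> real" where g: "convex_on UNIV g" "\<And>\<xi>. f \<xi> = g (\<xi>, det \<xi>)"
      unfolding polyconvex_fun_def by auto
    have "f (\<Sum>i=1..5. t i *\<^sub>R \<xi> i) = g (\<Sum>i=1..5. t i *\<^sub>R (\<xi> i, det (\<xi> i)))"
      unfolding g(2) d[symmetric] by (simp add: sum_prod)
    also have "\<dots> \<le> (\<Sum>i=1..5. t i * g (\<xi> i, det (\<xi> i)))"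
      using h t by (intro convex_on_sum[OF _ _ g(1)]) auto
    also have "\<dots> \<le> 0"
      using h f by (intro sum_nonpos mult_nonneg_nonpos) (auto simp: pc_hull_def simp flip: g(2))
    finally show "f (\<Sum>i=1..5. t i *\<^sub>R \<xi> i) \<le> 0" .
  qed
qed

lemma subset_pc_hull: "E \<subseteq> pc_hull E"
  by (auto simp: pc_hull_def)

lemma subset_rc_hull: "E \<subseteq> rc_hull E"
  by (auto simp: rc_hull_def)

lemma Pco_subset_pc_hull: "Pco E \<subseteq> pc_hull E"
  using polyconvex_set_pc_hull subset_pc_hull by (auto simp: Pco_def)

lemma rc_hull_mono: "A \<subseteq> B \<Longrightarrow> rc_hull A \<subseteq> rc_hull B"
  and pc_hull_mono: "A \<subseteq> B \<Longrightarrow> pc_hull A \<subseteq> pc_hull B"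
  and Pco_mono: "A \<subseteq> B \<Longrightarrow> Pco A \<subseteq> Pco B"
  by (auto simp: rc_hull_def pc_hull_def Pco_def)

lemma rc_hull_idem: "rc_hull (rc_hull E) = rc_hull E"
  by (auto simp: rc_hull_def)

text \<open>Both \<open>rc_hull E\<close> and \<open>Pco E\<close> lie between the lamination hull
  and \<open>pc_hull E\<close>, so one inclusion collapses everything.\<close>

lemma hulls_eq_if_pc_hull_subset_lam:
  assumes "pc_hull E \<subseteq> lamination_hull E"
  shows "rc_hull E = pc_hull E" "pc_hull E = Pco E"
  using assms lam_subset_rc_hull rc_hull_subset_pc_hull lam_subset_Pco Pco_subset_pc_hull by blast+

section \<open>Polyconvex test functions\<close>

lemma polyconvex_funI:
  assumes "convex_on UNIV h"
  shows "polyconvex_fun (\<lambda>\<xi>. h \<xi> + c * det \<xi>)"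
  unfolding polyconvex_fun_def
proof (intro exI conjI allI)
  show "convex_on UNIV (\<lambda>(\<xi>, d). h \<xi> + c * d)"
  proof (rule convex_onI)
    fix t :: real and x y :: "mat2 \<times> real"
    assume "0 < t" "t < 1"
    then show "(case (1 - t) *\<^sub>R x + t *\<^sub>R y of (\<xi>, d) \<Rightarrow> h \<xi> + c * d)
        \<le> (1 - t) * (case x of (\<xi>, d) \<Rightarrow> h \<xi> + c * d) + t * (case y of (\<xi>, d) \<Rightarrow> h \<xi> + c * d)"
      using convex_onD[OF assms, of t "fst x" "fst y"]
      by (simp add: case_prod_unfold algebra_simps)
  qed simp
qed simp

lemma convex_on_norm_linear:
  assumes "linear l"
  shows "convex_on UNIV (\<lambda>x. norm (l x))"
proof (rule convex_onI)
  fix t :: real and x y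
  assume t: "0 < t" "t < 1"
  have "norm (l ((1 - t) *\<^sub>R x + t *\<^sub>R y)) = norm ((1 - t) *\<^sub>R l x + t *\<^sub>R l y)"
    using assms by (simp add: linear_add linear_scale)
  also have "\<dots> \<le> (1 - t) * norm (l x) + t * norm (l y)"
    using t norm_triangle_ineq[of "(1 - t) *\<^sub>R l x" "t *\<^sub>R l y"] by simp
  finally show "norm (l ((1 - t) *\<^sub>R x + t *\<^sub>R y)) \<le> (1 - t) * norm (l x) + t * norm (l y)" .
qed simp

lemma pc_hull_le:
  assumes "\<xi> \<in> pc_hull E" "convex_on UNIV h" "\<And>\<eta>. \<eta> \<in> E \<Longrightarrow> h \<eta> + c * det \<eta> \<le> b"
  shows "h \<xi> + c * det \<xi> \<le> b"
proof -
  have "convex_on UNIV (\<lambda>\<xi>. h \<xi> - b)"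
    using convex_on_add[OF assms(2), of "\<lambda>_. - b"] by (simp add: convex_on_const)
  from polyconvex_funI[OF this, of c] show ?thesis
    using assms(1,3) unfolding pc_hull_def
    by (auto dest!: spec[of _ "\<lambda>\<xi>. h \<xi> - b + c * det \<xi>"] simp: algebra_simps)
qed

section \<open>Translations and idempotence for open sets\<close>

lemma rc_hull_translate:
  assumes "\<xi> \<in> rc_hull E"
  shows "\<xi> + v \<in> rc_hull ((\<lambda>x. x + v) ` E)"
  unfolding rc_hull_def
proof clarify
  fix f assume f: "rank_one_convex f" "\<forall>x\<in>(\<lambda>x. x + v) ` E. f x \<le> 0"
  have "rank_one_convex (\<lambda>x. f (x + v))"
    unfolding rank_one_convex_def
  proof (intro allI impI convex_onI)
    fix \<xi> \<eta> a b :: mat2 and t :: real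
    assume r: "rank (\<xi> - \<eta>) = 1" and t: "0 < t" "t < 1" and ab: "a \<in> closed_segment \<xi> \<eta>" "b \<in> closed_segment \<xi> \<eta>"
    have c: "convex_on (closed_segment (v + \<xi>) (v + \<eta>)) f"
      using f(1) r unfolding rank_one_convex_def by simp
    have "a + v \<in> closed_segment (v + \<xi>) (v + \<eta>)" "b + v \<in> closed_segment (v + \<xi>) (v + \<eta>)"
      using ab unfolding closed_segment_translation by (auto simp: add.commute)
    from convex_onD[OF c _ _ this, of t] t
    have "f ((1 - t) *\<^sub>R (a + v) + t *\<^sub>R (b + v)) \<le> (1 - t) * f (a + v) + t * f (b + v)"
      by simp
    moreover have "(1 - t) *\<^sub>R (a + v) + t *\<^sub>R (b + v) = (1 - t) *\<^sub>R a + t *\<^sub>R b + v"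
      by (simp add: algebra_simps)
    ultimately show "f ((1 - t) *\<^sub>R a + t *\<^sub>R b + v) \<le> (1 - t) * f (a + v) + t * f (b + v)" by simp
  qed simp
  then show "f (\<xi> + v) \<le> 0" using assms f(2) unfolding rc_hull_def by auto
qed

text \<open>A compact part of the open hull is covered by finitely many balls, each inside the hull
  of one compact subset of \<open>U\<close>. The union of these subsets is compact, and
  \<open>rc_hull_idem\<close> finishes.\<close>

lemma rc_hull_open_idem:
  assumes "open U"
  shows "rc_hull_open (rc_hull_open U) = rc_hull_open U"
proof
  show "rc_hull_open U \<subseteq> rc_hull_open (rc_hull_open U)"
  proof
    fix \<xi> assume "\<xi> \<in> rc_hull_open U"
    then have "{\<xi>} \<subseteq> rc_hull_open U \<and> compact {\<xi>}" by simp
    moreover have "\<xi> \<in> rc_hull {\<xi>}" using subset_rc_hull by blast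
    ultimately show "\<xi> \<in> rc_hull_open (rc_hull_open U)" unfolding rc_hull_open_def by blast
  qed
  show "rc_hull_open (rc_hull_open U) \<subseteq> rc_hull_open U"
  proof
    fix \<xi> assume "\<xi> \<in> rc_hull_open (rc_hull_open U)"
    then obtain E where E: "E \<subseteq> rc_hull_open U" "compact E" "\<xi> \<in> rc_hull E"
      by (auto simp: rc_hull_open_def)
    have "\<exists>e C. 0 < e \<and> compact C \<and> C \<subseteq> U \<and> ball \<eta> e \<subseteq> rc_hull C" if "\<eta> \<in> E" for \<eta>
    proof -
      obtain C where C: "C \<subseteq> U" "compact C" "\<eta> \<in> rc_hull C"
        using \<open>\<eta> \<in> E\<close> E(1) by (auto simp: rc_hull_open_def)
      obtain e where e: "0 < e" "(\<Union>x\<in>C. cball x e) \<subseteq> U"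
        using compact_subset_open_imp_cball_epsilon_subset[OF C(2) assms C(1)] .
      \<comment> \<open>This thickening contains every translate of \<open>C\<close> by a vector of
        length at most \<open>e\<close>, so its hull contains a ball around
        \<open>\<eta>\<close>.\<close>
      define C' where "C' = (\<Union>x\<in>C. \<Union>v\<in>cball 0 e. {x + v})"
      have "compact C'" unfolding C'_def by (intro compact_sums' C(2)) simp
      moreover have "C' \<subseteq> U"
      proof
        fix y assume "y \<in> C'"
        then obtain x v where "x \<in> C" "norm v \<le> e" "y = x + v" by (auto simp: C'_def)
        then have "x \<in> C" "y \<in> cball x e" by (simp_all add: dist_norm)
        then show "y \<in> U" using e(2) by blast
      qed
      moreover have "\<zeta> \<in> rc_hull C'" if "\<zeta> \<in> ball \<eta> e" for \<zeta>
      proof -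
        have "(\<lambda>x. x + (\<zeta> - \<eta>)) ` C \<subseteq> C'"
          using that by (auto simp: C'_def dist_norm norm_minus_commute)
        from rc_hull_mono[OF this] show ?thesis using rc_hull_translate[OF C(3), of "\<zeta> - \<eta>"] by auto
      qed
      ultimately show ?thesis using e(1) by blast
    qed
    then have "\<forall>\<eta>\<in>E. \<exists>p. 0 < fst p \<and> compact (snd p) \<and> snd p \<subseteq> U \<and> ball \<eta> (fst p) \<subseteq> rc_hull (snd p)"
      by (metis fst_conv snd_conv)
    from bchoice[OF this] obtain p where
      p: "\<And>\<eta>. \<eta> \<in> E \<Longrightarrow> 0 < fst (p \<eta>) \<and> compact (snd (p \<eta>)) \<and> snd (p \<eta>) \<subseteq> U \<and> ball \<eta> (fst (p \<eta>)) \<subseteq> rc_hull (snd (p \<eta>))"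
      by blast
    define e C where "e \<eta> = fst (p \<eta>)" and "C \<eta> = snd (p \<eta>)" for \<eta>
    have eC: "0 < e \<eta> \<and> compact (C \<eta>) \<and> C \<eta> \<subseteq> U \<and> ball \<eta> (e \<eta>) \<subseteq> rc_hull (C \<eta>)" if "\<eta> \<in> E" for \<eta>
      using p[OF that] by (simp add: e_def C_def)
    obtain F where F: "F \<subseteq> E" "finite F" "E \<subseteq> (\<Union>\<eta>\<in>F. ball \<eta> (e \<eta>))"
    proof (rule compactE_image[OF E(2), of E "\<lambda>\<eta>. ball \<eta> (e \<eta>)"])
      show "E \<subseteq> (\<Union>\<eta>\<in>E. ball \<eta> (e \<eta>))" using eC by force
    qed auto
    define G where "G = (\<Union>\<eta>\<in>F. C \<eta>)"
    have "compact G" unfolding G_def using F eC by (intro compact_UN) auto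
    moreover have "G \<subseteq> U" using F eC by (auto simp: G_def)
    moreover have "E \<subseteq> rc_hull G"
    proof
      fix \<eta> assume "\<eta> \<in> E"
      then obtain \<zeta> where "\<zeta> \<in> F" "\<eta> \<in> rc_hull (C \<zeta>)" using F eC by blast
      then show "\<eta> \<in> rc_hull G" using rc_hull_mono[of "C \<zeta>" G] by (auto simp: G_def)
    qed
    then have "\<xi> \<in> rc_hull G" using E(3) rc_hull_mono rc_hull_idem by blast
    ultimately show "\<xi> \<in> rc_hull_open U" unfolding rc_hull_open_def by blast
  qed
qed

section \<open>Lamination hulls of sets described by singular values\<close>

text \<open>Invariance is stated through singular values: level sets then satisfy it trivially, and
  isotropic sets are shown to satisfy it later.\<close>

definition spectral :: "mat2 set \<Rightarrow> bool" where
  "spectral A \<longleftrightarrow> (\<forall>\<xi> \<eta>. \<xi> \<in> A \<and> lambda1 \<eta> = lambda1 \<xi> \<and> lambda2 \<eta> = lambda2 \<xi> \<longrightarrow> \<eta> \<in> A)"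

text \<open>Sum and absolute difference determine two moduli up to order; exchanging them reverses
  the sign of \<open>det\<close>.\<close>

lemma lambda_eq_iff:
  "lambda1 \<eta> = lambda1 \<xi> \<and> lambda2 \<eta> = lambda2 \<xi> \<longleftrightarrow>
    cmod (zc \<eta>) = cmod (zc \<xi>) \<and> cmod (wc \<eta>) = cmod (wc \<xi>) \<or>
    cmod (zc \<eta>) = cmod (wc \<xi>) \<and> cmod (wc \<eta>) = cmod (zc \<xi>)"
  unfolding lambda1_conformal lambda2_conformal by argo

lemma lambda_range: "0 \<le> lambda1 \<xi>" "lambda1 \<xi> \<le> lambda2 \<xi>"
  by (auto simp: lambda1_conformal lambda2_conformal abs_le_iff add_increasing)

lemma conformal_lambda_nonneg_det:
  assumes "0 \<le> det \<xi>"
  shows "det \<xi> = lambda1 \<xi> * lambda2 \<xi>"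
    "cmod (zc \<xi>) = (lambda2 \<xi> + lambda1 \<xi>) / 2" "cmod (wc \<xi>) = (lambda2 \<xi> - lambda1 \<xi>) / 2"
proof -
  have "cmod (wc \<xi>) \<le> cmod (zc \<xi>)"
    using assms power_strict_mono[of "cmod (zc \<xi>)" "cmod (wc \<xi>)" 2] by (force simp: det_conformal)
  then show "det \<xi> = lambda1 \<xi> * lambda2 \<xi>"
    "cmod (zc \<xi>) = (lambda2 \<xi> + lambda1 \<xi>) / 2" "cmod (wc \<xi>) = (lambda2 \<xi> - lambda1 \<xi>) / 2"
    by (simp_all add: lambda1_conformal lambda2_conformal det_conformal power2_eq_square algebra_simps)
qed

lemma conformal_lambda_neg_det:
  assumes "det \<xi> < 0"
  shows "det \<xi> = - (lambda1 \<xi> * lambda2 \<xi>)"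
    "cmod (zc \<xi>) = (lambda2 \<xi> - lambda1 \<xi>) / 2" "cmod (wc \<xi>) = (lambda2 \<xi> + lambda1 \<xi>) / 2"
proof -
  have "cmod (zc \<xi>) \<le> cmod (wc \<xi>)"
    using assms power_mono[of "cmod (wc \<xi>)" "cmod (zc \<xi>)" 2] unfolding det_conformal by fastforce
  then show "det \<xi> = - (lambda1 \<xi> * lambda2 \<xi>)"
    "cmod (zc \<xi>) = (lambda2 \<xi> - lambda1 \<xi>) / 2" "cmod (wc \<xi>) = (lambda2 \<xi> + lambda1 \<xi>) / 2"
    by (simp_all add: lambda1_conformal lambda2_conformal det_conformal power2_eq_square algebra_simps)
qed

lemma spectral_mk:
  assumes "spectral A" "mk z w \<in> A" "cmod z' = cmod z" "cmod w' = cmod w"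
  shows "mk z' w' \<in> A" "mk w' z' \<in> A"
  using assms lambda_eq_iff[of "mk z' w'" "mk z w"] lambda_eq_iff[of "mk w' z'" "mk z w"]
  unfolding spectral_def by (metis zc_mk wc_mk)+

lemma complex_unit_multiple:
  fixes z z' :: complex
  assumes "cmod z' = cmod z"
  obtains p where "cmod p = 1" "z' = p * z"
proof (cases "z = 0")
  case True
  then show ?thesis using assms that[of 1] by simp
next
  case False
  then show ?thesis using assms that[of "z' / z"] by (simp add: norm_divide)
qed

lemma det_mk_diff: "det (mk z w - mk z' w') = (cmod (z - z'))\<^sup>2 - (cmod (w - w'))\<^sup>2"
  by (simp add: mk_diff det_conformal)

lemma lam_linear_image:
  assumes "linear \<phi>" "\<And>\<xi>. det \<xi> = 0 \<Longrightarrow> det (\<phi> \<xi>) = 0" "\<And>\<xi>. \<xi> \<in> E \<Longrightarrow> \<phi> \<xi> \<in> E" "\<xi> \<in> lamination_hull E"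
  shows "\<phi> \<xi> \<in> lamination_hull E"
  using assms(4)
proof induction
  case (lam_base \<xi>)
  then show ?case using assms(3) by (simp add: lamination_hull.lam_base)
next
  case (lam_step \<xi> \<eta> t)
  then show ?case
    using lamination_hull.lam_step[OF lam_step.IH] assms(1,2) lam_step.hyps
    by (simp add: linear_add linear_scale flip: linear_diff)
qed

text \<open>Equal singular values are related by rotating the two conformal parts independently and
  possibly swapping them. These linear maps preserve \<open>E\<close> and zero determinants, so they
  act on the hull.\<close>

lemma spectral_lam:
  assumes "spectral E"
  shows "spectral (lamination_hull E)"
  unfolding spectral_def
proof (intro allI impI, elim conjE)
  fix \<xi> \<eta>
  assume x: "\<xi> \<in> lamination_hull E" and l: "lambda1 \<eta> = lambda1 \<xi>" "lambda2 \<eta> = lambda2 \<xi>"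
  have rot: "mk (p * zc \<zeta>) (q * wc \<zeta>) \<in> lamination_hull E" if "cmod p = 1" "cmod q = 1" "\<zeta> \<in> lamination_hull E" for p q \<zeta>
  proof (rule lam_linear_image[OF _ _ _ that(3)])
    show "linear (\<lambda>\<zeta>. mk (p * zc \<zeta>) (q * wc \<zeta>))"
      by (rule linearI) (simp_all add: mk_add mk_scaleR ring_distribs)
    show "det (mk (p * zc \<zeta>) (q * wc \<zeta>)) = 0" if "det \<zeta> = 0" for \<zeta>
      using that \<open>cmod p = 1\<close> \<open>cmod q = 1\<close> by (simp add: det_conformal norm_mult)
    show "mk (p * zc \<zeta>) (q * wc \<zeta>) \<in> E" if "\<zeta> \<in> E" for \<zeta>
      using spectral_mk(1)[OF assms, of "zc \<zeta>" "wc \<zeta>"] that \<open>cmod p = 1\<close> \<open>cmod q = 1\<close>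
      by (simp add: norm_mult)
  qed
  have swap: "mk (wc \<zeta>) (zc \<zeta>) \<in> lamination_hull E" if "\<zeta> \<in> lamination_hull E" for \<zeta>
  proof (rule lam_linear_image[OF _ _ _ that])
    show "linear (\<lambda>\<zeta>. mk (wc \<zeta>) (zc \<zeta>))"
      by (rule linearI) (simp_all add: mk_add mk_scaleR)
    show "det (mk (wc \<zeta>) (zc \<zeta>)) = 0" if "det \<zeta> = 0" for \<zeta>
      using that by (simp add: det_conformal)
    show "mk (wc \<zeta>) (zc \<zeta>) \<in> E" if "\<zeta> \<in> E" for \<zeta>
      using spectral_mk(2)[OF assms, of "zc \<zeta>" "wc \<zeta>"] that by simp
  qed
  have eq: "\<zeta>' \<in> lamination_hull E" if \<zeta>: "\<zeta> \<in> lamination_hull E" "cmod (zc \<zeta>') = cmod (zc \<zeta>)" "cmod (wc \<zeta>') = cmod (wc \<zeta>)" for \<zeta> \<zeta>'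
  proof -
    obtain p where p: "cmod p = 1" "zc \<zeta>' = p * zc \<zeta>" using complex_unit_multiple[OF \<zeta>(2)] .
    obtain q where q: "cmod q = 1" "wc \<zeta>' = q * wc \<zeta>" using complex_unit_multiple[OF \<zeta>(3)] .
    show ?thesis using rot[OF p(1) q(1) \<zeta>(1)] by (simp flip: p(2) q(2))
  qed
  show "\<eta> \<in> lamination_hull E"
    using l eq[OF x, of \<eta>] eq[OF swap[OF x], of \<eta>] lambda_eq_iff[of \<eta> \<xi>] by auto
qed

text \<open>The arguments are ordered as the singular values: \<open>diag2 x y\<close> is the diagonal matrix with entries \<open>y, x\<close>.\<close>

definition diag2 :: "real \<Rightarrow> real \<Rightarrow> mat2" where
  "diag2 x y = mk (of_real ((y + x) / 2)) (of_real ((y - x) / 2))"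

lemma lambda_diag2:
  assumes "0 \<le> x" "x \<le> y"
  shows "lambda1 (diag2 x y) = x" "lambda2 (diag2 x y) = y"
  using assms by (simp_all add: lambda1_conformal lambda2_conformal diag2_def field_simps del: of_real_divide of_real_add of_real_diff)

section \<open>Geometry of spectral sets closed under rank-one segments\<close>

locale spectral_rank_one_closed =
  fixes L :: "mat2 set"
  assumes spectral: "spectral L"
    and segment: "\<And>\<xi> \<eta> t. \<xi> \<in> L \<Longrightarrow> \<eta> \<in> L \<Longrightarrow> det (\<xi> - \<eta>) = 0 \<Longrightarrow> 0 \<le> t \<Longrightarrow> t \<le> 1 \<Longrightarrow>
      (1 - t) *\<^sub>R \<xi> + t *\<^sub>R \<eta> \<in> L"
begin

lemma segment_mk:
  assumes "mk z w \<in> L" "mk z' w' \<in> L" "cmod (z - z') = cmod (w - w')" "0 \<le> t" "t \<le> 1"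
  shows "mk ((1 - t) *\<^sub>R z + t *\<^sub>R z') ((1 - t) *\<^sub>R w + t *\<^sub>R w') \<in> L"
  using segment[OF assms(1,2) _ assms(4,5)] assms(3) by (simp add: det_mk_diff mk_scaleR mk_add)

lemma diag2_sym:
  assumes "diag2 x y \<in> L"
  shows "diag2 y x \<in> L" "diag2 (- x) y \<in> L"
  using spectral_mk[OF spectral assms[unfolded diag2_def]]
  unfolding diag2_def by (simp_all add: norm_minus_commute add.commute flip: of_real_diff of_real_add)

text \<open>Negating one diagonal entry keeps the singular values and is a rank-one change, so the
  whole segment between \<open>x\<close> and \<open>- x\<close> is available.\<close>

lemma diag2_shrink1:
  assumes "diag2 x y \<in> L" "\<bar>x'\<bar> \<le> \<bar>x\<bar>"
  shows "diag2 x' y \<in> L"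
proof (cases "x = 0")
  case True
  then show ?thesis using assms by simp
next
  case False
  define t where "t = (1 - x' / x) / 2"
  have "\<bar>x' / x\<bar> \<le> 1" using assms(2) False by simp
  then have t: "0 \<le> t" "t \<le> 1" unfolding t_def abs_le_iff by simp_all
  have x': "x' = (1 - t) * x + t * (- x)" using False by (simp add: t_def field_simps)
  have e: "(1 - t) *\<^sub>R diag2 x y + t *\<^sub>R diag2 (- x) y = diag2 x' y"
    unfolding x' diag2_def mk_scaleR mk_add by (intro arg_cong2[of _ _ _ _ mk]) (simp_all add: complex_eq_iff field_simps)
  have "det (diag2 x y - diag2 (- x) y) = 0"
    unfolding diag2_def det_mk_diff by (simp add: field_simps norm_minus_commute flip: of_real_diff of_real_add)
  from segment[OF assms(1) diag2_sym(2)[OF assms(1)] this t] show ?thesis by (simp add: e)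
qed

lemma diag2_shrink:
  assumes "diag2 x y \<in> L" "\<bar>x'\<bar> \<le> \<bar>x\<bar>" "\<bar>y'\<bar> \<le> \<bar>y\<bar>"
  shows "diag2 x' y' \<in> L"
  using diag2_sym(1)[OF diag2_shrink1[OF diag2_sym(1)[OF diag2_shrink1[OF assms(1,2)]] assms(3)]] .

text \<open>Moving \<open>zc\<close> and \<open>wc\<close> by the same orthogonal amount \<open>\<plusminus>h\<close> is a rank-one change that keeps
  the determinant, so the midpoints run along a hyperbola.\<close>

lemma diag2_hyperbola:
  assumes "diag2 x y \<in> L" "0 \<le> x" "x \<le> x'" "x' \<le> y'" "y' \<le> y" "x' * y' = x * y"
  shows "diag2 x' y' \<in> L"
proof -
  \<comment> \<open>\<open>h\<close> is chosen so that both end points have singular values \<open>x, y\<close>\<close>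
  define h where "h = sqrt (((y - x) / 2)\<^sup>2 - ((y' - x') / 2)\<^sup>2)"
  have "((y' - x') / 2)\<^sup>2 \<le> ((y - x) / 2)\<^sup>2" using assms by (intro power_mono) auto
  then have h2: "h\<^sup>2 = ((y - x) / 2)\<^sup>2 - ((y' - x') / 2)\<^sup>2" by (simp add: h_def)
  have "((y + x) / 2)\<^sup>2 - ((y - x) / 2)\<^sup>2 = ((y' + x') / 2)\<^sup>2 - ((y' - x') / 2)\<^sup>2"
    using assms(6) by (simp add: power2_eq_square field_simps)
  then have h2': "h\<^sup>2 = ((y + x) / 2)\<^sup>2 - ((y' + x') / 2)\<^sup>2" using h2 by simp
  have in_L: "mk (Complex ((y' + x') / 2) k) (Complex ((y' - x') / 2) k) \<in> L" if "k\<^sup>2 = h\<^sup>2" for k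
  proof (rule spectral_mk(1)[OF spectral assms(1)[unfolded diag2_def]])
    show "cmod (Complex ((y' + x') / 2) k) = cmod (of_real ((y + x) / 2))"
      unfolding cmod_def complex.sel that h2' by simp
    show "cmod (Complex ((y' - x') / 2) k) = cmod (of_real ((y - x) / 2))"
      unfolding cmod_def complex.sel that h2 by simp
  qed
  let ?z = "(1 - 1/2) *\<^sub>R Complex ((y' + x') / 2) h + (1/2) *\<^sub>R Complex ((y' + x') / 2) (- h)"
  let ?w = "(1 - 1/2) *\<^sub>R Complex ((y' - x') / 2) h + (1/2) *\<^sub>R Complex ((y' - x') / 2) (- h)"
  have "mk ?z ?w \<in> L"
    by (intro segment_mk in_L) (simp_all add: cmod_def)
  moreover have "mk ?z ?w = diag2 x' y'"
    unfolding diag2_def by (intro arg_cong2[of _ _ _ _ mk]) (simp_all add: complex_eq_iff)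
  ultimately show ?thesis by simp
qed

text \<open>Slide along the hyperbola of constant product until the first entry is
  \<open>x'\<close>, then shrink the second entry from \<open>Y\<close> to
  \<open>y'\<close>.\<close>

lemma diag2_dominated:
  assumes "diag2 x y \<in> L" "0 \<le> x" "x \<le> y" "0 \<le> x'" "x' \<le> y'" "y' \<le> y" "x' * y' \<le> x * y"
  shows "diag2 x' y' \<in> L"
proof (cases "x' \<le> x")
  case True
  then show ?thesis using assms by (intro diag2_shrink[OF assms(1)]) auto
next
  case False
  define Y where "Y = x * y / x'"
  have x': "0 < x'" using False assms(2) by simp
  have Y: "x' * Y = x * y" "y' \<le> Y" using x' assms(7) by (simp_all add: Y_def field_simps)
  moreover have "Y \<le> y" using False x' assms(2,3) by (simp add: Y_def divide_le_eq mult.commute mult_right_mono)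
  ultimately have "diag2 x' Y \<in> L" using assms False by (intro diag2_hyperbola[OF assms(1)]) auto
  then show ?thesis using Y assms by (elim diag2_shrink) auto
qed

text \<open>The part of \<open>L\<close> with nonnegative determinant in the coordinates \<open>D = det \<xi>\<close>, \<open>r = cmod (wc \<xi>)\<close>.\<close>

definition S :: "(real \<times> real) set" where
  "S = {(D, r). 0 \<le> D \<and> 0 \<le> r \<and> diag2 (sqrt (D + r\<^sup>2) - r) (sqrt (D + r\<^sup>2) + r) \<in> L}"

text \<open>Since \<open>D\<close> is the difference of the squared moduli,
  \<open>sqrt (D + r\<^sup>2)\<close> is the modulus of the \<open>zc\<close> part; the arguments of
  \<open>diag2\<close> in \<open>S\<close> are therefore the singular values.\<close>

lemma S_diag2_iff:
  assumes "0 \<le> x" "x \<le> y"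
  shows "(x * y, (y - x) / 2) \<in> S \<longleftrightarrow> diag2 x y \<in> L"
proof -
  have "x * y + ((y - x) / 2)\<^sup>2 = ((y + x) / 2)\<^sup>2" by (simp add: power2_eq_square field_simps)
  then have "sqrt (x * y + ((y - x) / 2)\<^sup>2) = (y + x) / 2" using assms by simp
  then show ?thesis using assms by (simp add: S_def field_simps)
qed

lemma S_memE:
  assumes "(D, r) \<in> S"
  obtains x y where "0 \<le> x" "x \<le> y" "D = x * y" "r = (y - x) / 2" "diag2 x y \<in> L"
proof (rule that)
  have "0 \<le> D" "0 \<le> r" using assms by (auto simp: S_def)
  then show "0 \<le> sqrt (D + r\<^sup>2) - r" by (simp add: real_le_rsqrt)
  show "D = (sqrt (D + r\<^sup>2) - r) * (sqrt (D + r\<^sup>2) + r)"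
    using \<open>0 \<le> D\<close> by (simp add: algebra_simps power2_eq_square flip: real_sqrt_mult)
qed (use assms in \<open>auto simp: S_def\<close>)

text \<open>The condition \<open>D + 2 * y * r \<le> y\<^sup>2\<close>, together with
  \<open>r \<le> y\<close>, bounds the larger singular value by \<open>y\<close>. Unlike that bound
  it is linear in \<open>(D, r)\<close>, hence suited to convex combinations.\<close>

lemma S_dominated:
  assumes "diag2 x y \<in> L" "0 \<le> x" "x \<le> y" "0 \<le> D" "D \<le> x * y" "0 \<le> r" "D + 2 * y * r \<le> y\<^sup>2" "r \<le> y"
  shows "(D, r) \<in> S"
proof -
  define Z where "Z = sqrt (D + r\<^sup>2)"
  have Z: "r \<le> Z" "Z\<^sup>2 = D + r\<^sup>2" using assms by (simp_all add: Z_def real_le_rsqrt)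
  have "Z \<le> y - r" unfolding Z_def using assms
    by (intro real_le_lsqrt) (auto simp: power2_eq_square algebra_simps)
  moreover have "(Z - r) * (Z + r) = D" using Z(2) by (simp add: power2_eq_square algebra_simps)
  ultimately have "diag2 (Z - r) (Z + r) \<in> L"
    using assms Z(1) by (intro diag2_dominated[OF assms(1-3)]) auto
  then show ?thesis using assms by (simp add: S_def Z_def)
qed

lemma S_mono:
  assumes "(D, r) \<in> S" "0 \<le> D'" "D' \<le> D" "0 \<le> r'" "r' \<le> r"
  shows "(D', r') \<in> S"
proof -
  obtain x y where xy: "0 \<le> x" "x \<le> y" "D = x * y" "r = (y - x) / 2" "diag2 x y \<in> L"
    using S_memE[OF assms(1)] .
  have "y * r' \<le> y * r" using assms xy by (intro mult_left_mono) auto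
  moreover have "x * y + 2 * y * r = y\<^sup>2" by (simp add: xy(4) power2_eq_square field_simps)
  ultimately show ?thesis using assms xy by (intro S_dominated[OF xy(5)]) auto
qed

text \<open>The larger pair dominates the smaller one, so the linear criterion of
  \<open>S_dominated\<close> for \<open>x2, y2\<close> carries over to the combination.\<close>

lemma S_combine_increasing:
  assumes "diag2 x2 y2 \<in> L" "0 \<le> x1" "x1 \<le> y1" "x1 \<le> x2" "y1 \<le> y2" "x2 \<le> y2" "0 \<le> s" "0 \<le> t" "s + t = 1"
  shows "(s * (x1 * y1) + t * (x2 * y2), s * ((y1 - x1) / 2) + t * ((y2 - x2) / 2)) \<in> S"
proof (rule S_dominated[OF assms(1)])
  have s: "s = 1 - t" using assms by simp
  have "x1 * y1 \<le> x2 * y2" using assms by (intro mult_mono) auto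
  then have "s * (x1 * y1) \<le> s * (x2 * y2)" using assms by (intro mult_left_mono) auto
  then show "s * (x1 * y1) + t * (x2 * y2) \<le> x2 * y2" by (simp add: s algebra_simps)
  \<comment> \<open>This product is exactly the slack in the next inequality.\<close>
  have "0 \<le> s * ((y2 + x1) * (y2 - y1))" using assms by simp
  then show "s * (x1 * y1) + t * (x2 * y2) + 2 * y2 * (s * ((y1 - x1) / 2) + t * ((y2 - x2) / 2)) \<le> y2\<^sup>2"
    by (simp add: s power2_eq_square field_simps)
  have "s * ((y1 - x1) / 2) \<le> s * y2" "t * ((y2 - x2) / 2) \<le> t * y2"
    using assms by (intro mult_left_mono; simp)+
  then show "s * ((y1 - x1) / 2) + t * ((y2 - x2) / 2) \<le> y2"
    using assms(9) by (metis add_mono distrib_right mult_1)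
qed (use assms in auto)

text \<open>Two matrices with parallel \<open>wc\<close> and suitably rotated \<open>zc\<close> are rank-one connected: the
  triangle inequalities required for the rotation are exactly the monotonicity of the pairs.\<close>

lemma S_combine_decreasing:
  assumes "diag2 x1 y1 \<in> L" "diag2 x2 y2 \<in> L" "0 \<le> x2" "x2 \<le> x1" "x1 \<le> y1" "y1 \<le> y2" "0 \<le> s" "0 \<le> t" "s + t = 1"
  shows "(s * (x1 * y1) + t * (x2 * y2), s * ((y1 - x1) / 2) + t * ((y2 - x2) / 2)) \<in> S"
proof -
  define Z1 Z2 W1 W2 where defs: "Z1 = (y1 + x1) / 2" "Z2 = (y2 + x2) / 2" "W1 = (y1 - x1) / 2" "W2 = (y2 - x2) / 2"
  have s: "s = 1 - t" "t \<le> 1" using assms by simp_all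
  have nn: "0 \<le> Z1" "0 \<le> Z2" "0 \<le> W1" "0 \<le> W2" "W1 \<le> W2" using assms by (auto simp: defs)
  \<comment> \<open>As the angle runs from 0 to \<open>pi\<close>, the distance passes from the
    difference of \<open>Z1\<close> and \<open>Z2\<close> to their sum. The value
    \<open>W2 - W1\<close> in between gives a rank-one connection.\<close>
  have "\<exists>\<theta>. 0 \<le> \<theta> \<and> \<theta> \<le> pi \<and> cmod (of_real Z1 - rcis Z2 \<theta>) = W2 - W1"
  proof (rule IVT')
    show "cmod (of_real Z1 - rcis Z2 0) \<le> W2 - W1"
      using assms by (simp add: rcis_def defs abs_le_iff field_simps flip: of_real_diff del: of_real_divide of_real_add)
    show "W2 - W1 \<le> cmod (of_real Z1 - rcis Z2 pi)"
      using assms by (simp add: rcis_def defs field_simps flip: of_real_add del: of_real_divide)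
    show "continuous_on {0..pi} (\<lambda>\<theta>. cmod (of_real Z1 - rcis Z2 \<theta>))"
      unfolding rcis_def cis_conv_exp by (intro continuous_intros)
  qed simp
  then obtain \<theta> where \<theta>: "cmod (of_real Z1 - rcis Z2 \<theta>) = W2 - W1" by blast
  define z2 where "z2 = rcis Z2 \<theta>"
  have c2: "cmod z2 = Z2" using nn by (simp add: z2_def)
  define z where "z = (1 - t) *\<^sub>R of_real Z1 + t *\<^sub>R z2"
  define w where "w = s * W1 + t * W2"
  have m1: "mk (of_real Z1) (of_real W1) \<in> L" using assms(1) by (simp add: diag2_def defs)
  have "mk (of_real Z2) (of_real W2) \<in> L" using assms(2) by (simp add: diag2_def defs)
  then have m2: "mk z2 (of_real W2) \<in> L" using spectral_mk(1)[OF spectral] c2 nn by simp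
  have "mk z ((1 - t) *\<^sub>R of_real W1 + t *\<^sub>R of_real W2) \<in> L"
    unfolding z_def using \<theta> nn assms s
    by (intro segment_mk m1 m2) (simp_all add: z2_def norm_minus_commute flip: of_real_diff)
  moreover have w': "of_real w = (1 - t) *\<^sub>R complex_of_real W1 + t *\<^sub>R complex_of_real W2"
    by (simp add: w_def s scaleR_conv_of_real)
  ultimately have mz: "mk z (of_real w) \<in> L" by simp
  define D where "D = s * (x1 * y1) + t * (x2 * y2)"
  \<comment> \<open>Along this segment \<open>det\<close> is affine and the \<open>wc\<close> parts
    are nonnegative reals, so both coordinates \<open>D\<close> and \<open>r\<close> interpolate
    linearly.\<close>
  have "det (mk z (of_real w)) = D"
  proof -
    have "mk z (of_real w) = (1 - t) *\<^sub>R mk (of_real Z1) (of_real W1) + t *\<^sub>R mk z2 (of_real W2)"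
      by (simp add: mk_scaleR mk_add z_def w')
    moreover have "det (mk (of_real Z1) (of_real W1) - mk z2 (of_real W2)) = 0"
      using \<theta> by (simp add: det_mk_diff z2_def power2_commute flip: of_real_diff)
    moreover have "det (mk (of_real Z1) (of_real W1)) = Z1\<^sup>2 - W1\<^sup>2" "det (mk z2 (of_real W2)) = Z2\<^sup>2 - W2\<^sup>2"
      by (simp_all add: det_conformal c2)
    moreover have "Z1\<^sup>2 - W1\<^sup>2 = x1 * y1" "Z2\<^sup>2 - W2\<^sup>2 = x2 * y2"
      by (simp_all add: defs power2_eq_square field_simps)
    ultimately show ?thesis by (simp add: det_segment D_def s)
  qed
  then have "(cmod z)\<^sup>2 = D + w\<^sup>2" by (simp add: det_conformal)
  then have cz: "sqrt (D + w\<^sup>2) = cmod z" by (simp flip: \<open>(cmod z)\<^sup>2 = D + w\<^sup>2\<close>)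
  have w0: "0 \<le> w" using nn assms by (simp add: w_def)
  have "0 \<le> D" using assms by (simp add: D_def)
  moreover have "mk (of_real (cmod z)) (of_real w) \<in> L"
    by (rule spectral_mk(1)[OF spectral mz]) auto
  ultimately have "(D, w) \<in> S" using w0 by (simp add: S_def cz diag2_def)
  then show ?thesis by (simp add: D_def w_def defs)
qed

text \<open>Two pairs of singular values are either ordered componentwise or nested as intervals;
  the two combination lemmas cover these cases.\<close>

lemma convex_S: "convex S"
proof (rule convexI, clarify)
  fix D1 r1 D2 r2 s t :: real
  assume 1: "(D1, r1) \<in> S" and 2: "(D2, r2) \<in> S" and st: "0 \<le> s" "0 \<le> t" "s + t = 1"
  obtain x1 y1 where p1: "0 \<le> x1" "x1 \<le> y1" "D1 = x1 * y1" "r1 = (y1 - x1) / 2" "diag2 x1 y1 \<in> L"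
    using S_memE[OF 1] .
  obtain x2 y2 where p2: "0 \<le> x2" "x2 \<le> y2" "D2 = x2 * y2" "r2 = (y2 - x2) / 2" "diag2 x2 y2 \<in> L"
    using S_memE[OF 2] .
  have ts: "t + s = 1" using st by simp
  consider "x1 \<le> x2" "y1 \<le> y2" | "x2 \<le> x1" "y2 \<le> y1" | "x2 \<le> x1" "y1 \<le> y2" | "x1 \<le> x2" "y2 \<le> y1"
    by linarith
  then have "(s * (x1 * y1) + t * (x2 * y2), s * ((y1 - x1) / 2) + t * ((y2 - x2) / 2)) \<in> S"
  proof cases
    case 1
    then show ?thesis using S_combine_increasing[OF p2(5) p1(1,2) _ _ p2(2) st] p1 p2 by simp
  next
    case 2
    then show ?thesis using S_combine_increasing[OF p1(5) p2(1,2) _ _ p1(2) st(2,1) ts] p1 p2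
      by (simp add: add.commute)
  next
    case 3
    then show ?thesis using S_combine_decreasing[OF p1(5) p2(5,1) _ p1(2) _ st] p1 p2 by simp
  next
    case 4
    then show ?thesis using S_combine_decreasing[OF p2(5) p1(5,1) _ p2(2) _ st(2,1) ts] p1 p2
      by (simp add: add.commute)
  qed
  then show "s *\<^sub>R (D1, r1) + t *\<^sub>R (D2, r2) \<in> S" by (simp add: p1(3,4) p2(3,4))
qed

end

lemma spectral_rank_one_closed_lam:
  assumes "spectral E"
  shows "spectral_rank_one_closed (lamination_hull E)"
  using assms by unfold_locales (auto intro: spectral_lam lamination_hull.lam_step)

lemma continuous_on_zc [continuous_intros]: "continuous_on A zc"
  and continuous_on_wc [continuous_intros]: "continuous_on A wc"
  using linear_zc linear_wc by (simp_all add: linear_continuous_on linear_conv_bounded_linear)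

lemma continuous_on_lambda1: "continuous_on A lambda1"
  and continuous_on_lambda2: "continuous_on A lambda2"
  unfolding lambda1_conformal[abs_def] lambda2_conformal[abs_def]
  by (intro continuous_intros)+

section \<open>The polyconvex hull lies in the lamination hull\<close>

text \<open>The functions \<open>c * det + k * cmod wc\<close> and
  \<open>- c * det + k * cmod zc\<close> exchange their roles when \<open>det\<close> changes sign.
  Both are bounded on \<open>E\<close> by the hypotheses, and the sign of \<open>det \<xi>\<close>
  selects the one to evaluate.\<close>

lemma pc_hull_singular_value_bound:
  assumes \<xi>: "\<xi> \<in> pc_hull E" and "0 \<le> c" "0 \<le> k"
    and E: "\<And>\<eta>. \<eta> \<in> E \<Longrightarrow> c * (lambda1 \<eta> * lambda2 \<eta>) + k * ((lambda2 \<eta> - lambda1 \<eta>) / 2) \<le> b"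
      "\<And>\<eta>. \<eta> \<in> E \<Longrightarrow> k * ((lambda2 \<eta> + lambda1 \<eta>) / 2) - c * (lambda1 \<eta> * lambda2 \<eta>) \<le> b"
  shows "c * (lambda1 \<xi> * lambda2 \<xi>) + k * ((lambda2 \<xi> - lambda1 \<xi>) / 2) \<le> b"
proof -
  have cvx: "convex_on UNIV (\<lambda>\<xi>. k * cmod (wc \<xi>))" "convex_on UNIV (\<lambda>\<xi>. k * cmod (zc \<xi>))"
    using assms(3) by (simp_all add: convex_on_cmul convex_on_norm_linear linear_zc linear_wc)
  have "k * cmod (wc \<eta>) + c * det \<eta> \<le> b" "k * cmod (zc \<eta>) + (- c) * det \<eta> \<le> b" if "\<eta> \<in> E" for \<eta>
  proof -
    show "k * cmod (wc \<eta>) + c * det \<eta> \<le> b"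
    proof (cases "0 \<le> det \<eta>")
      case True
      show ?thesis unfolding conformal_lambda_nonneg_det[OF True] using E(1)[OF that] by simp
    next
      case False
      show ?thesis unfolding conformal_lambda_neg_det[OF False[unfolded not_le]] using E(2)[OF that] by simp
    qed
    show "k * cmod (zc \<eta>) + (- c) * det \<eta> \<le> b"
    proof (cases "0 \<le> det \<eta>")
      case True
      show ?thesis unfolding conformal_lambda_nonneg_det[OF True] using E(2)[OF that] by simp
    next
      case False
      show ?thesis unfolding conformal_lambda_neg_det[OF False[unfolded not_le]] using E(1)[OF that] by simp
    qed
  qed
  note E' = this
  have le: "k * cmod (wc \<xi>) + c * det \<xi> \<le> b" "k * cmod (zc \<xi>) + (- c) * det \<xi> \<le> b"
    using pc_hull_le[OF \<xi> cvx(1) E'(1)] pc_hull_le[OF \<xi> cvx(2) E'(2)] by auto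
  show ?thesis
  proof (cases "0 \<le> det \<xi>")
    case True
    show ?thesis using le(1) unfolding conformal_lambda_nonneg_det[OF True] by simp
  next
    case False
    show ?thesis using le(2) unfolding conformal_lambda_neg_det[OF False[unfolded not_le]] by simp
  qed
qed

text \<open>The larger singular value is a sum of two norms of linear maps, hence convex.\<close>

lemma pc_hull_lambda2_le:
  assumes "\<xi> \<in> pc_hull E" "\<And>\<eta>. \<eta> \<in> E \<Longrightarrow> lambda2 \<eta> \<le> b"
  shows "lambda2 \<xi> \<le> b"
proof -
  have "convex_on UNIV lambda2"
    unfolding lambda2_conformal[abs_def]
    by (intro convex_on_add convex_on_norm_linear linear_zc linear_wc)
  from pc_hull_le[OF assms(1) this, of 0 b] show ?thesis using assms(2) by simp
qed

text \<open>The functional \<open>c D + k r\<close> on the reflected matrix of determinant \<open>- x y\<close>.\<close>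

lemma reflected_value_le:
  fixes x y B c k b :: real
  assumes "0 \<le> x" "x \<le> y" "y \<le> B" "0 \<le> c" "0 \<le> k" "k \<le> 2 * c * B"
    and b: "c * (x * y) + k * ((y - x) / 2) \<le> b" "k * (B / 2) \<le> b"
  shows "k * ((y + x) / 2) - c * (x * y) \<le> b"
proof (cases "k \<le> 2 * c * y")
  \<comment> \<open>The reflected value exceeds the original one by
    \<open>x * (k - 2 * c * y)\<close>.\<close>
  case True
  then have "x * k \<le> x * (2 * c * y)" using assms(1) by (rule mult_left_mono)
  then show ?thesis using b(1) by (simp add: field_simps)
next
  case False
  then have c: "0 < c" using assms by (cases "c = 0") auto
  \<comment> \<open>With this \<open>s\<close> the reflected value is
    \<open>c * (s\<^sup>2 - (s - x) * (s - y))\<close>, to be compared with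
    \<open>c * s * B\<close>, the value of \<open>k * (B / 2)\<close>.\<close>
  define s where "s = k / (2 * c)"
  have k: "k = 2 * c * s" using c by (simp add: s_def)
  have s: "y \<le> s" "s \<le> B" using False assms(6) c by (auto simp: k)
  have "s\<^sup>2 - (s - x) * (s - y) \<le> s * B"
  proof -
    have "0 \<le> (s - x) * (s - y)" using s assms by simp
    moreover have "s\<^sup>2 \<le> s * B" using s assms by (simp add: power2_eq_square mult_left_mono)
    ultimately show ?thesis by simp
  qed
  then have "c * (s\<^sup>2 - (s - x) * (s - y)) \<le> c * (s * B)" using c by simp
  then show ?thesis using b(2) by (simp add: k power2_eq_square algebra_simps)
qed

lemma pc_hull_subset_lam:
  assumes "compact E" "spectral E"
  shows "pc_hull E \<subseteq> lamination_hull E"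
proof (cases "E = {}")
  case True
  have "\<xi> \<notin> pc_hull {}" for \<xi>
    using pc_hull_le[of \<xi> "{}" "\<lambda>_. 0" 0 "-1"] by (auto simp: convex_on_const)
  then show ?thesis using True by auto
next
  case False
  interpret spectral_rank_one_closed "lamination_hull E"
    using spectral_rank_one_closed_lam[OF assms(2)] .
  obtain \<xi>B where B: "\<xi>B \<in> E" "\<And>\<eta>. \<eta> \<in> E \<Longrightarrow> lambda2 \<eta> \<le> lambda2 \<xi>B"
    using continuous_attains_sup[OF assms(1) False continuous_on_lambda2] by blast
  define B where "B = lambda2 \<xi>B"
  define \<Phi> where "\<Phi> = (\<lambda>\<eta>. (lambda1 \<eta> * lambda2 \<eta>, (lambda2 \<eta> - lambda1 \<eta>) / 2))"
  \<comment> \<open>The extra vertex represents \<open>diag2 0 B\<close>, obtained by shrinking a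
    maximizer of \<open>lambda2\<close>. It will supply \<open>k * (B / 2) < b\<close>, and
    compactness of \<open>C\<close> gives strict separation.\<close>
  define C where "C = convex hull (insert (0, B / 2) (\<Phi> ` E))"
  have diag2_iff: "diag2 (lambda1 \<eta>) (lambda2 \<eta>) \<in> lamination_hull E \<longleftrightarrow> \<eta> \<in> lamination_hull E" for \<eta>
    using spectral lambda_diag2[OF lambda_range, of \<eta>] unfolding spectral_def by metis
  have S_iff: "\<Phi> \<eta> \<in> S \<longleftrightarrow> \<eta> \<in> lamination_hull E" for \<eta>
    unfolding \<Phi>_def using S_diag2_iff[OF lambda_range] diag2_iff by blast
  have "compact C"
    unfolding C_def \<Phi>_def
    by (intro compact_convex_hull compact_insert compact_continuous_image assms(1)
        continuous_intros continuous_on_lambda1 continuous_on_lambda2) auto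
  have "C \<subseteq> S"
    unfolding C_def
  proof (rule hull_minimal)
    have B0: "0 \<le> B" using lambda_range[of \<xi>B] by (simp add: B_def)
    have "diag2 (lambda1 \<xi>B) B \<in> lamination_hull E" using diag2_iff lam_base[OF B(1)] by (simp add: B_def)
    then have "diag2 0 B \<in> lamination_hull E" by (rule diag2_shrink) auto
    then have "(0, B / 2) \<in> S" using S_diag2_iff[of 0 B] B0 by simp
    then show "insert (0, B / 2) (\<Phi> ` E) \<subseteq> S" using S_iff lam_base by auto
  qed (rule convex_S)
  show ?thesis
  proof
    fix \<xi> assume \<xi>: "\<xi> \<in> pc_hull E"
    define x y where "x = lambda1 \<xi>" and "y = lambda2 \<xi>"
    have xy: "0 \<le> x" "x \<le> y" "y \<le> B"
      using lambda_range[of \<xi>] pc_hull_lambda2_le[OF \<xi>] B(2) by (auto simp: x_def y_def B_def)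
    show "\<xi> \<in> lamination_hull E"
    proof (rule ccontr)
      assume "\<xi> \<notin> lamination_hull E"
      then have n: "(x * y, (y - x) / 2) \<notin> S" using S_iff[of \<xi>] by (simp add: \<Phi>_def x_def y_def)
      \<comment> \<open>By \<open>S_mono\<close> the whole quadrant above the excluded point misses
        \<open>S\<close>; separating from a quadrant forces both coefficients to be
        nonnegative.\<close>
      define Q where "Q = {x * y..} \<times> {(y - x) / 2..}"
      have "C \<inter> Q = {}"
      proof (rule ccontr)
        assume "C \<inter> Q \<noteq> {}"
        then obtain p where "p \<in> S" "p \<in> Q" using \<open>C \<subseteq> S\<close> by blast
        then obtain D r where "(D, r) \<in> S" "x * y \<le> D" "(y - x) / 2 \<le> r"
          by (cases p) (simp add: Q_def)
        then show False using S_mono[of D r "x * y" "(y - x) / 2"] n xy by simp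
      qed
      moreover have "convex Q" "closed Q" "convex C" "C \<noteq> {}"
        by (auto simp: Q_def C_def intro!: convex_Times closed_Times)
      ultimately obtain a b where ab: "\<forall>p\<in>C. a \<bullet> p < b" "\<forall>p\<in>Q. b < a \<bullet> p"
        using separating_hyperplane_compact_closed[of C Q] \<open>compact C\<close> by blast
      obtain c k where a: "a = (c, k)" by (cases a)
      have Q: "b < c * D + k * r" if "x * y \<le> D" "(y - x) / 2 \<le> r" for D r
        using ab(2) that by (auto simp: Q_def a)
      have C: "c * D + k * r < b" if "(D, r) \<in> C" for D r
        using ab(1) that by (auto simp: a)
      have bQ: "b < c * (x * y) + k * ((y - x) / 2)" by (rule Q) auto
      have c: "0 \<le> c"
      proof (rule ccontr)
        assume "\<not> 0 \<le> c"
        then show False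
          \<comment> \<open>With \<open>c < 0\<close>, this point of the quadrant gives the
            functional the value \<open>b\<close>, contradicting strictness.\<close>
          using bQ Q[of "x * y + (c * (x * y) + k * ((y - x) / 2) - b) / (- c)" "(y - x) / 2"]
          by (simp add: field_simps)
      qed
      have k: "0 \<le> k"
      proof (rule ccontr)
        assume "\<not> 0 \<le> k"
        then show False
          using bQ Q[of "x * y" "(y - x) / 2 + (c * (x * y) + k * ((y - x) / 2) - b) / (- k)"]
          by (simp add: field_simps)
      qed
      have "(0, B / 2) \<in> C" by (simp add: C_def hull_inc)
      then have bB: "k * (B / 2) < b" using C[of 0 "B / 2"] by simp
      have bE: "c * (lambda1 \<eta> * lambda2 \<eta>) + k * ((lambda2 \<eta> - lambda1 \<eta>) / 2) < b" if "\<eta> \<in> E" for \<eta>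
      proof (rule C)
        have "\<Phi> \<eta> \<in> C" using that by (simp add: C_def hull_inc)
        then show "(lambda1 \<eta> * lambda2 \<eta>, (lambda2 \<eta> - lambda1 \<eta>) / 2) \<in> C" by (simp add: \<Phi>_def)
      qed
      show False
      proof (cases "k \<le> 2 * c * B")
        case True
        have "k * ((lambda2 \<eta> + lambda1 \<eta>) / 2) - c * (lambda1 \<eta> * lambda2 \<eta>) \<le> b" if "\<eta> \<in> E" for \<eta>
          using reflected_value_le[OF lambda_range _ c k True, of \<eta> b] B(2)[OF that] bE[OF that] bB
          by (simp add: B_def)
        then have "c * (x * y) + k * ((y - x) / 2) \<le> b"
          unfolding x_def y_def using bE by (intro pc_hull_singular_value_bound[OF \<xi> c k]) (auto intro: less_imp_le)
        then show False using bQ by simp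
      next
        case False
        \<comment> \<open>For such large \<open>k\<close> the functional at the excluded point is at
          most \<open>k * (y / 2)\<close>, so the extra vertex alone gives the
          contradiction.\<close>
        have "c * y \<le> c * B" using xy c by (simp add: mult_left_mono)
        then have "x * (c * y) \<le> x * (k / 2)" using xy False by (intro mult_left_mono) auto
        moreover have "k * y \<le> k * B" using xy k by (simp add: mult_left_mono)
        ultimately show False using bQ bB by (simp add: field_simps)
      qed
    qed
  qed
qed

section \<open>Isotropic sets and the theorem\<close>

text \<open>Multiplying by rotations \<open>u\<close> on the left and \<open>v\<close> on the right
  multiplies \<open>zc\<close> by \<open>u * v\<close> and \<open>wc\<close> by
  \<open>u * cnj v\<close>; the reflection \<open>mk 0 1\<close> swaps the parts.\<close>

lemma isotropic_imp_spectral: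
  assumes "isotropic U"
  shows "spectral U"
  unfolding spectral_def
proof (intro allI impI, elim conjE)
  fix \<xi> \<eta>
  assume x: "\<xi> \<in> U" and l: "lambda1 \<eta> = lambda1 \<xi>" "lambda2 \<eta> = lambda2 \<xi>"
  have orth: "R ** \<zeta> ** S \<in> U" if "orthogonal_matrix R" "orthogonal_matrix S" "\<zeta> \<in> U" for R S \<zeta>
    using assms that unfolding isotropic_def by blast
  have mm: "mk a b ** mk c d = mk (a * c + b * cnj d) (a * d + b * cnj c)" for a b c d
    by (simp add: mat2_eq_iff matrix_matrix_mult_def sum_2 algebra_simps)
  have o1: "orthogonal_matrix (mk u 0)" "orthogonal_matrix (mk 0 u)" if "cmod u = 1" for u
  proof -
    have "(Re u)\<^sup>2 + (Im u)\<^sup>2 = 1" using that by (simp flip: cmod_power2)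
    then show "orthogonal_matrix (mk u 0)" "orthogonal_matrix (mk 0 u)"
      unfolding orthogonal_matrix
      by (simp_all add: mat2_eq_iff matrix_matrix_mult_def sum_2 transpose_def mat_def power2_eq_square)
  qed
  have rot: "mk (p * z) (q * w) \<in> U" if "cmod p = 1" "cmod q = 1" "mk z w \<in> U" for p q z w
  proof -
    \<comment> \<open>For unimodular \<open>v\<close>, the equations \<open>u * v = p\<close> and
      \<open>u * cnj v = q\<close> force \<open>u * u = p * q\<close> and
      \<open>v = p / u\<close>.\<close>
    define u where "u = csqrt (p * q)"
    have u2: "u * u = p * q" using power2_csqrt[of "p * q"] by (simp add: u_def power2_eq_square)
    have u1: "cmod u = 1" using that by (simp add: u_def norm_mult norm_csqrt)
    define v where "v = p / u"
    have v1: "cmod v = 1" using that u1 by (simp add: v_def norm_divide)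
    have u0: "u \<noteq> 0" using u1 by auto
    have uv: "u * v = p" using u0 by (simp add: v_def)
    have p0: "p \<noteq> 0" using that(1) by auto
    have "cnj v * v = 1" using v1 complex_norm_square[of v] by (simp add: mult.commute)
    then have "(u * cnj v) * (u * v) = u * u" by (simp add: ac_simps)
    then have ucv: "u * cnj v = q" using p0 by (simp add: uv u2)
    have "mk u 0 ** mk z w ** mk v 0 = mk (p * z) (q * w)"
      unfolding mm uv[symmetric] ucv[symmetric] by (simp add: ac_simps)
    then show ?thesis using orth[OF o1(1)[OF u1] o1(1)[OF v1] that(3)] by simp
  qed
  have eq: "mk z' w' \<in> U" if zw: "mk z w \<in> U" "cmod z' = cmod z" "cmod w' = cmod w" for z w z' w'
  proof -
    obtain p where p: "cmod p = 1" "z' = p * z" using complex_unit_multiple[OF zw(2)] .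
    obtain q where q: "cmod q = 1" "w' = q * w" using complex_unit_multiple[OF zw(3)] .
    show ?thesis using rot[OF p(1) q(1) zw(1)] p q by simp
  qed
  have "mk 1 0 ** mk z w ** mk 0 1 = mk w z" for z w by (simp add: mm)
  from this[of "zc \<xi>" "wc \<xi>"] have "mk (wc \<xi>) (zc \<xi>) \<in> U"
    using orth[OF o1(1)[of 1] o1(2)[of 1] x] by simp
  then show "\<eta> \<in> U"
    using l lambda_eq_iff[of \<eta> \<xi>] eq[of "zc \<xi>" "wc \<xi>" "zc \<eta>" "wc \<eta>"] eq[of "wc \<xi>" "zc \<xi>" "zc \<eta>" "wc \<eta>"] x
    by auto
qed

section \<open>Compact spectral sets and exhaustion\<close>

lemma compact_spectral_level:
  assumes "compact K"
  shows "compact {\<xi>. (lambda1 \<xi>, lambda2 \<xi>) \<in> K}" (is "compact ?E")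
proof (rule compact_eq_bounded_closed[THEN iffD2, OF conjI])
  have "closed ((\<lambda>\<xi>. (lambda1 \<xi>, lambda2 \<xi>)) -` K)"
    using assms by (intro closed_vimage compact_imp_closed continuous_on_Pair continuous_on_lambda1 continuous_on_lambda2)
  then show "closed ?E" by (simp add: vimage_def)
  obtain M where M: "\<And>p. p \<in> K \<Longrightarrow> norm p \<le> M"
    using compact_imp_bounded[OF assms] unfolding bounded_iff by blast
  have "?E \<subseteq> (\<lambda>(z, w). mk z w) ` (cball 0 M \<times> cball 0 M)"
  proof
    fix \<xi> assume "\<xi> \<in> ?E"
    then have "norm (lambda1 \<xi>, lambda2 \<xi>) \<le> M" using M by simp
    then have "lambda2 \<xi> \<le> M" using norm_snd_le[of "lambda2 \<xi>" "lambda1 \<xi>"] by simp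
    then have "cmod (zc \<xi>) \<le> M" "cmod (wc \<xi>) \<le> M" unfolding lambda2_conformal
      using norm_ge_zero[of "zc \<xi>"] norm_ge_zero[of "wc \<xi>"] by linarith+
    then show "\<xi> \<in> (\<lambda>(z, w). mk z w) ` (cball 0 M \<times> cball 0 M)"
      by (intro image_eqI[of _ _ "(zc \<xi>, wc \<xi>)"]) simp_all
  qed
  moreover have "linear (\<lambda>(z, w). mk z w)"
    by (rule linearI) (auto simp: mk_add mk_scaleR)
  then have "bounded ((\<lambda>(z, w). mk z w) ` (cball 0 M \<times> cball 0 M))"
    by (intro bounded_linear_image bounded_Times bounded_cball) (simp add: linear_conv_bounded_linear)
  ultimately show "bounded ?E" by (rule bounded_subset[rotated])
qed

lemma spectral_level: "spectral {\<xi>. (lambda1 \<xi>, lambda2 \<xi>) \<in> K}"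
  by (simp add: spectral_def)

lemma compact_spectral_hulls:
  assumes "compact E" "spectral E"
  shows "rc_hull E = pc_hull E" "pc_hull E = Pco E"
  using hulls_eq_if_pc_hull_subset_lam[OF pc_hull_subset_lam[OF assms]] .

text \<open>Adding all matrices that share singular values with a point of \<open>E\<close> keeps
  compactness and stays in \<open>U\<close>, so the hulls of \<open>U\<close> can be exhausted by
  spectral sets.\<close>

lemma compact_spectral_saturation:
  assumes "compact E" "E \<subseteq> U" "spectral U"
  obtains F where "compact F" "spectral F" "E \<subseteq> F" "F \<subseteq> U"
proof (rule that)
  let ?F = "{\<xi>. (lambda1 \<xi>, lambda2 \<xi>) \<in> (\<lambda>\<xi>. (lambda1 \<xi>, lambda2 \<xi>)) ` E}"
  show "compact ?F"
    by (intro compact_spectral_level compact_continuous_image assms(1) continuous_on_Pair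
        continuous_on_lambda1 continuous_on_lambda2)
  show "?F \<subseteq> U"
  proof
    fix \<xi> assume "\<xi> \<in> ?F"
    then obtain \<eta> where "\<eta> \<in> E" "lambda1 \<xi> = lambda1 \<eta>" "lambda2 \<xi> = lambda2 \<eta>" by auto
    then show "\<xi> \<in> U" using assms(2,3) unfolding spectral_def by blast
  qed
qed (auto intro: spectral_level)

lemma rc_hull_open_eq_pc_hull_open:
  assumes "spectral U"
  shows "rc_hull_open U = pc_hull_open U"
proof
  show "rc_hull_open U \<subseteq> pc_hull_open U"
    unfolding rc_hull_open_def pc_hull_open_def using rc_hull_subset_pc_hull by blast
  show "pc_hull_open U \<subseteq> rc_hull_open U"
  proof
    fix \<xi> assume "\<xi> \<in> pc_hull_open U"
    then obtain E where E: "E \<subseteq> U" "compact E" "\<xi> \<in> pc_hull E" by (auto simp: pc_hull_open_def)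
    obtain F where F: "compact F" "spectral F" "E \<subseteq> F" "F \<subseteq> U"
      using compact_spectral_saturation[OF E(2,1) assms] .
    have "\<xi> \<in> rc_hull F" using E(3) pc_hull_mono[OF F(3)] compact_spectral_hulls(1)[OF F(1,2)] by blast
    then show "\<xi> \<in> rc_hull_open U" using F unfolding rc_hull_open_def by blast
  qed
qed

text \<open>A polyconvex combination involves only five points, hence five compact sets, whose union
  is again a compact subset of \<open>U\<close>; so the open hull is itself polyconvex.\<close>

lemma pc_hull_open_eq_Pco:
  assumes "spectral U"
  shows "pc_hull_open U = Pco U"
proof
  show "pc_hull_open U \<subseteq> Pco U"
  proof
    fix \<xi> assume "\<xi> \<in> pc_hull_open U"
    then obtain E where E: "E \<subseteq> U" "compact E" "\<xi> \<in> pc_hull E" by (auto simp: pc_hull_open_def)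
    obtain F where F: "compact F" "spectral F" "E \<subseteq> F" "F \<subseteq> U"
      using compact_spectral_saturation[OF E(2,1) assms] .
    then show "\<xi> \<in> Pco U"
      using E(3) pc_hull_mono[OF F(3)] compact_spectral_hulls(2)[OF F(1,2)] Pco_mono[OF F(4)] by blast
  qed
  have "polyconvex_set (pc_hull_open U)"
    unfolding polyconvex_set_def
  proof clarify
    fix \<xi> :: "nat \<Rightarrow> mat2" and t :: "nat \<Rightarrow> real"
    assume h: "\<forall>i\<in>{1..5}. \<xi> i \<in> pc_hull_open U \<and> 0 \<le> t i" and t: "(\<Sum>i=1..5. t i) = 1"
      and d: "(\<Sum>i=1..5. t i * det (\<xi> i)) = det (\<Sum>i=1..5. t i *\<^sub>R \<xi> i)"
    have "\<forall>i\<in>{1..5}. \<exists>E. E \<subseteq> U \<and> compact E \<and> \<xi> i \<in> pc_hull E"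
      using h by (auto simp: pc_hull_open_def)
    from bchoice[OF this] obtain E where
      E: "\<And>i. i \<in> {1..5} \<Longrightarrow> E i \<subseteq> U \<and> compact (E i) \<and> \<xi> i \<in> pc_hull (E i)" by blast
    define F where "F = (\<Union>i\<in>{1..5}. E i)"
    have "F \<subseteq> U" unfolding F_def using E by blast
    moreover have "compact F" unfolding F_def using E by (intro compact_UN) auto
    moreover have "\<forall>i\<in>{1..5}. \<xi> i \<in> pc_hull F \<and> 0 \<le> t i"
    proof
      fix i :: nat assume i: "i \<in> {1..5}"
      then have "E i \<subseteq> F" by (auto simp: F_def)
      then show "\<xi> i \<in> pc_hull F \<and> 0 \<le> t i" using pc_hull_mono[of "E i" F] E[OF i] h i by blast
    qed
    then have "(\<Sum>i=1..5. t i *\<^sub>R \<xi> i) \<in> pc_hull F"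
      using polyconvex_set_pc_hull[of F] t d unfolding polyconvex_set_def by blast
    ultimately show "(\<Sum>i=1..5. t i *\<^sub>R \<xi> i) \<in> pc_hull_open U"
      unfolding pc_hull_open_def by blast
  qed
  moreover have "U \<subseteq> pc_hull_open U"
  proof
    fix \<xi> assume "\<xi> \<in> U"
    then have "{\<xi>} \<subseteq> U \<and> compact {\<xi>}" by simp
    moreover have "\<xi> \<in> pc_hull {\<xi>}" using subset_pc_hull by blast
    ultimately show "\<xi> \<in> pc_hull_open U" unfolding pc_hull_open_def by blast
  qed
  ultimately show "Pco U \<subseteq> pc_hull_open U" by (auto simp: Pco_def)
qed

theorem theorem3p3:
  shows "(\<forall>K :: (real \<times> real) set.
            compact K \<and> K \<subseteq> {(x, y). 0 < x \<and> x \<le> y} \<longrightarrow>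
            (let E = {\<xi>. (lambda1 \<xi>, lambda2 \<xi>) \<in> K}
             in rc_hull E = pc_hull E \<and> pc_hull E = Pco E))
       \<and> (\<forall>U :: mat2 set. open U \<and> bounded U \<and> isotropic U \<longrightarrow>
            rc_hull_open U = pc_hull_open U \<and> pc_hull_open U = Pco U \<and>
            rc_hull_open (rc_hull_open U) = rc_hull_open U)"
  unfolding Let_def
proof (intro conjI allI impI; elim conjE)
  fix K :: "(real \<times> real) set"
  assume "compact K"
  then show "rc_hull {\<xi>. (lambda1 \<xi>, lambda2 \<xi>) \<in> K} = pc_hull {\<xi>. (lambda1 \<xi>, lambda2 \<xi>) \<in> K}"
    "pc_hull {\<xi>. (lambda1 \<xi>, lambda2 \<xi>) \<in> K} = Pco {\<xi>. (lambda1 \<xi>, lambda2 \<xi>) \<in> K}"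
    using compact_spectral_hulls[OF compact_spectral_level spectral_level] by blast+
next
  fix U :: "mat2 set"
  assume "open U" "isotropic U"
  then show "rc_hull_open U = pc_hull_open U" "pc_hull_open U = Pco U"
    "rc_hull_open (rc_hull_open U) = rc_hull_open U"
    using rc_hull_open_eq_pc_hull_open[OF isotropic_imp_spectral]
      pc_hull_open_eq_Pco[OF isotropic_imp_spectral] rc_hull_open_idem[of U] by blast+
qed

end
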